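(* Let $A,B\in\mathbb{C}_{n,n}$ with $\mathrm{Ind}(A)=k$, $\mathrm{Ind}(B)=t$, $\mathrm{rk}(A^{k})=\mathrm{rk}\big((A^{k})^{\sim}A^{k}\big)=r$ and $\mathrm{rk}(B^{t})=\mathrm{rk}\big((B^{t})^{\sim}B^{t}\big)=s\ge r$. If $A\overset{(\mathrm{E})}{\leq}B$, then there exists a unitary matrix $\widehat{U}\in\mathbb{C}_{n,n}$ such that, with respect to the block sizes $r,\ s-r,\ n-s$, $$A=\widehat{U}\begin{bmatrix}T&S_1&S_2\\ 0&\widehat{N_{11}}&\widehat{N_{12}}\\ 0&\widehat{N_{13}}&\widehat{N_{14}}\end{bmatrix}\widehat{U}^*,$$ $$B=\widehat{U}\begin{bmatrix}T&S_1+G_1^{-1}\begin{bmatrix}G_{21}&G_{22}\end{bmatrix}\begin{bmatrix}\widehat{N_{11}}-\widetilde{T}\\ \widehat{N_{13}}\end{bmatrix}&S_2+G_1^{-1}\begin{bmatrix}G_{21}&G_{22}\end{bmatrix}\begin{bmatrix}\widehat{N_{12}}-\widehat{S}\\ \widehat{N_{14}}-\widehat{N}\end{bmatrix}\\ 0&\widetilde{T}&\widehat{S}\\ 0&0&\widehat{N}\end{bmatrix}\widehat{U}^*,$$ where $$\widehat{U}^*G\widehat{U}=\begin{bmatrix}G_1&G_{21}&G_{22}\\ G_{31}&G_{41}&G_{42}\\ G_{32}&G_{43}&G_{44}\end{bmatrix},$$ the matrices $\begin{bmatrix}\widehat{N_{11}}&\widehat{N_{12}}\\ \widehat{N_{13}}&\widehat{N_{14}}\end{bmatrix}\in\mathbb{C}_{n-r,n-r}$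 and $\widehat{N}\in\mathbb{C}_{n-s,n-s}$ are nilpotent, and the matrices $T\in\mathbb{C}_{r,r}$, $\widetilde{T}\in\mathbb{C}_{s-r,s-r}$, $G_1\in\mathbb{C}_{r,r}$ and $\widehat{G_1}=\begin{bmatrix}G_1&G_{21}\\ G_{31}&G_{41}\end{bmatrix}\in\mathbb{C}_{s,s}$ are invertible.
   Context: $\mathbb{C}_{m,n}$ is the set of $m\times n$ complex matrices; $A^*$, $\mathrm{rk}(A)$, $\mathcal{R}(A)$ denote conjugate transpose, rank and column space. $\mathrm{Ind}(A)$ is the smallest positive integer $k$ with $\mathrm{rk}(A^{k+1})=\mathrm{rk}(A^k)$. The Minkowski metric matrix is $G=\begin{bmatrix}1&0\\ 0&-I_{n-1}\end{bmatrix}$ and the Minkowski adjoint of $A$ is $A^{\sim}=GA^*G$. Blocks may be empty. For $A$ with $\mathrm{Ind}(A)=k$, the $\mathfrak{m}$-core-EP inverse $A^{(\mathrm{E})}$ of $A$ is the matrix $X\in\mathbb{C}_{n,n}$ (unique if it exists) satisfying $XAX=X$, $XA^{k+1}=A^k$, $(AX)^{\sim}=AX$ and $\mathcal{R}(X)\subseteq\mathcal{R}(A^k)$; it exists if and only if $\mathrm{rk}(A^k)=\mathrm{rk}((A^k)^{\sim}A^k)$. The $\mathfrak{m}$-core-EP order: for $A,B\in\mathbb{C}_{n,n}$ with $\mathrm{rk}(A^k)=\mathrm{rk}((A^k)^{\sim}A^k)$, $k=\mathrm{Ind}(A)$, write $A\overset{(\mathrm{E})}{\leq}B$ if $A^{(\mathrm{E})}A=A^{(\mathrm{E})}B$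 and $AA^{(\mathrm{E})}=BA^{(\mathrm{E})}$. *)

theory Defs
  imports
    "Jordan_Normal_Form.DL_Rank"
    "Jordan_Normal_Form.VS_Connect"
    "Jordan_Normal_Form.Schur_Decomposition"
    "Jordan_Normal_Form.Gauss_Jordan_Elimination"
begin

abbreviation rk :: "complex mat \<Rightarrow> nat" where
  "rk A \<equiv> vec_space.rank (dim_row A) A"

abbreviation column_space :: "complex mat \<Rightarrow> complex vec set" where
  "column_space A \<equiv> vec_space.col_space (dim_row A) A"

definition mat_index :: "complex mat \<Rightarrow> nat" where
  "mat_index A = (LEAST k. 0 < k \<and> rk (A ^\<^sub>m (k + 1)) = rk (A ^\<^sub>m k))"

text \<open>The Minkowski metric matrix; meaningful for \<open>n \<ge> 1\<close> only
  (for \<open>n = 0\<close> the formula yields a matrix of the wrong size).\<close>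

definition minkowski_metric :: "nat \<Rightarrow> complex mat" where
  "minkowski_metric n =
     four_block_mat (1\<^sub>m 1) (0\<^sub>m 1 (n - 1)) (0\<^sub>m (n - 1) 1) (- 1\<^sub>m (n - 1))"

definition minkowski_adjoint :: "complex mat \<Rightarrow> complex mat" where
  "minkowski_adjoint A =
     minkowski_metric (dim_col A) * mat_adjoint A * minkowski_metric (dim_row A)"

definition is_m_core_EP_inverse :: "complex mat \<Rightarrow> complex mat \<Rightarrow> bool" where
  "is_m_core_EP_inverse A X \<longleftrightarrow>
     X \<in> carrier_mat (dim_row A) (dim_row A) \<and>
     X * A * X = X \<and>
     X * A ^\<^sub>m (mat_index A + 1) = A ^\<^sub>m mat_index A \<and>
     minkowski_adjoint (A * X) = A * X \<and>
     column_space X \<subseteq> column_space (A ^\<^sub>m mat_index A)"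

text \<open>For square \<open>A\<close>, the description below denotes a matrix exactly under the rank condition
  \<open>m_core_EP_invertible\<close>, which the order therefore includes.\<close>

definition m_core_EP_inverse :: "complex mat \<Rightarrow> complex mat" where
  "m_core_EP_inverse A = (THE X. is_m_core_EP_inverse A X)"

definition m_core_EP_invertible :: "complex mat \<Rightarrow> bool" where
  "m_core_EP_invertible A \<longleftrightarrow>
     rk (A ^\<^sub>m mat_index A) =
     rk (minkowski_adjoint (A ^\<^sub>m mat_index A) * A ^\<^sub>m mat_index A)"

definition m_core_EP_le :: "complex mat \<Rightarrow> complex mat \<Rightarrow> bool" where
  "m_core_EP_le A B \<longleftrightarrow>
     m_core_EP_invertible A \<and>
     m_core_EP_inverse A * A = m_core_EP_inverse A * B \<and>
     A * m_core_EP_inverse A = B * m_core_EP_inverse A"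

definition unitary_mat :: "complex mat \<Rightarrow> bool" where
  "unitary_mat U \<longleftrightarrow>
     square_mat U \<and> mat_adjoint U * U = 1\<^sub>m (dim_row U) \<and> U * mat_adjoint U = 1\<^sub>m (dim_row U)"

definition nilpotent_mat :: "complex mat \<Rightarrow> bool" where
  "nilpotent_mat N \<longleftrightarrow> square_mat N \<and> (\<exists>m. N ^\<^sub>m m = 0\<^sub>m (dim_row N) (dim_row N))"

text \<open>\<open>mat_inverse\<close> returns \<open>Some\<close> inverse for every invertible matrix.\<close>

abbreviation mat_inv :: "complex mat \<Rightarrow> complex mat" where
  "mat_inv A \<equiv> the (mat_inverse A)"

definition append_cols :: "complex mat \<Rightarrow> complex mat \<Rightarrow> complex mat" (infixr "@\<^sub>c" 65) where
  "A @\<^sub>c B = four_block_mat A B (0\<^sub>m 0 (dim_col A)) (0\<^sub>m 0 (dim_col B))"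

text \<open>Arguments are listed row by row.\<close>

definition block3_mat ::
  "complex mat \<Rightarrow> complex mat \<Rightarrow> complex mat \<Rightarrow>
   complex mat \<Rightarrow> complex mat \<Rightarrow> complex mat \<Rightarrow>
   complex mat \<Rightarrow> complex mat \<Rightarrow> complex mat \<Rightarrow> complex mat" where
  "block3_mat X11 X12 X13 X21 X22 X23 X31 X32 X33 =
     (X11 @\<^sub>c X12 @\<^sub>c X13) @\<^sub>r (X21 @\<^sub>c X22 @\<^sub>c X23) @\<^sub>r (X31 @\<^sub>c X32 @\<^sub>c X33)"

end

theory Submission
  imports Defs
begin

text \<open>
  Let \<open>P\<close> and \<open>Q\<close> be orthonormal bases of the column spaces of \<open>A^k\<close> and \<open>B^t\<close>. Then \<open>A P = P T\<close> with
  \<open>T\<close> invertible, the Gram matrix \<open>G\<^sub>1 = P\<^sup>\<dagger> G P\<close> is invertible by the rank condition, and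
  the \<open>m\<close>-core-EP inverse of \<open>A\<close> is \<open>P T\<^sup>-\<^sup>1 G\<^sub>1\<^sup>-\<^sup>1 P\<^sup>\<dagger> G\<close>. Hence \<open>A \<le> B\<close> amounts to \<open>B P = A P\<close> and
  \<open>P\<^sup>\<dagger> G A = P\<^sup>\<dagger> G B\<close>. The first equation shows that the columns of \<open>P\<close> lie in every \<open>range (B^j)\<close>, so \<open>P\<close>
  extends to an orthonormal basis \<open>(P, D)\<close> of \<open>range (B^t)\<close> and then to a unitary \<open>(P, D, V)\<close>, in
  which \<open>A\<close> and \<open>B\<close> take the stated block shapes. Solving the second equation, written in this
  basis, for the first block row of \<open>B\<close> gives the remaining formula.
\<close>

section \<open>Adjoints and block matrices\<close>

notation mat_adjoint ("_\<^sup>\<dagger>" [1000] 1000)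

lemma mat_assoc:
  fixes A :: "'a :: semiring_0 mat"
  assumes "dim_col A = dim_row B" "dim_col B = dim_row C"
  shows "A * B * C = A * (B * C)"
  by (rule assoc_mult_mat[of A "dim_row A" "dim_row B" B "dim_row C" C "dim_col C"])
    (use assms in \<open>auto intro: carrier_matI\<close>)

lemma dim_mat_adjoint [simp]:
  "dim_row (A\<^sup>\<dagger>) = dim_col A" "dim_col (A\<^sup>\<dagger>) = dim_row A"
  by (auto simp: mat_adjoint_def)

lemma mat_adjoint_carrier [simp]:
  "A\<^sup>\<dagger> \<in> carrier_mat n m \<longleftrightarrow> A \<in> carrier_mat m n"
  by (metis carrier_matD carrier_matI dim_mat_adjoint)

lemma index_mat_adjoint [simp]:
  "i < dim_col A \<Longrightarrow> j < dim_row A \<Longrightarrow> A\<^sup>\<dagger> $$ (i, j) = conjugate (A $$ (j, i))"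
  by (simp add: mat_adjoint_def mat_of_rows_def)

lemma mat_adjoint_adjoint [simp]: "A\<^sup>\<dagger>\<^sup>\<dagger> = A"
  by (rule eq_matI) auto

lemma mat_adjoint_one [simp]: "(1\<^sub>m n)\<^sup>\<dagger> = (1\<^sub>m n :: complex mat)"
  by (rule eq_matI) auto

lemma mat_adjoint_zero [simp]: "(0\<^sub>m n m)\<^sup>\<dagger> = 0\<^sub>m m n"
  by (rule eq_matI) auto

lemma mat_adjoint_mult:
  fixes A B :: "complex mat"
  assumes "dim_col A = dim_row B"
  shows "(A * B)\<^sup>\<dagger> = B\<^sup>\<dagger> * A\<^sup>\<dagger>"
  by (rule eq_matI) (use assms in \<open>auto simp: scalar_prod_def mult.commute\<close>)

section \<open>Block rows, block columns and their products\<close>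

lemma append_cols_carrier [simp, intro]:
  "A \<in> carrier_mat n a \<Longrightarrow> B \<in> carrier_mat n b \<Longrightarrow> A @\<^sub>c B \<in> carrier_mat n (a + b)"
  unfolding append_cols_def by (intro carrier_matI) auto

lemma dim_append_cols [simp]:
  "dim_row (A @\<^sub>c B) = dim_row A" "dim_col (A @\<^sub>c B) = dim_col A + dim_col B"
  unfolding append_cols_def by auto

lemma dim_append_rows [simp]:
  "dim_row (A @\<^sub>r B) = dim_row A + dim_row B" "dim_col (A @\<^sub>r B) = dim_col A"
  unfolding append_rows_def by auto

lemma index_append_cols:
  "i < dim_row A \<Longrightarrow> j < dim_col A + dim_col B \<Longrightarrow>
    (A @\<^sub>c B) $$ (i, j) = (if j < dim_col A then A $$ (i, j) else B $$ (i, j - dim_col A))"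
  unfolding append_cols_def by auto

lemma index_append_rows:
  "i < dim_row A + dim_row B \<Longrightarrow> j < dim_col A \<Longrightarrow>
    (A @\<^sub>r B) $$ (i, j) = (if i < dim_row A then A $$ (i, j) else B $$ (i - dim_row A, j))"
  unfolding append_rows_def by auto

lemma mult_append_cols:
  assumes "dim_row B = dim_row C"
  shows "A * (B @\<^sub>c C) = A * B @\<^sub>c A * C"
  by (rule eq_matI)
    (use assms in \<open>auto simp: index_append_cols scalar_prod_def intro!: sum.cong\<close>)

lemma append_rows_mult:
  assumes "dim_col A = dim_col B" "dim_col A = dim_row C"
  shows "(A @\<^sub>r B) * C = A * C @\<^sub>r B * C"
  by (rule eq_matI)
    (use assms in \<open>auto simp: index_append_rows scalar_prod_def intro!: sum.cong\<close>)

text \<open>The sum over the inner index splits at \<open>dim_col A\<close>. Resolutions of the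
  identity by orthonormal blocks are obtained from this.\<close>

lemma append_cols_mult_append_rows:
  fixes A B C D :: "complex mat"
  assumes "dim_col A = dim_row C" "dim_col B = dim_row D" "dim_row A = dim_row B" "dim_col C = dim_col D"
  shows "(A @\<^sub>c B) * (C @\<^sub>r D) = A * C + B * D"
proof (rule eq_matI)
  fix i j assume ij: "i < dim_row (A * C + B * D)" "j < dim_col (A * C + B * D)"
  let ?f = "\<lambda>l. (A @\<^sub>c B) $$ (i, l) * (C @\<^sub>r D) $$ (l, j)"
  have "((A @\<^sub>c B) * (C @\<^sub>r D)) $$ (i, j) = sum ?f {0..<dim_col A + dim_col B}"
    using ij assms by (auto simp: scalar_prod_def intro!: sum.cong)
  also have "\<dots> = sum ?f {0..<dim_col A} + sum ?f {dim_col A..<dim_col A + dim_col B}"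
    by (simp add: sum.atLeastLessThan_concat)
  also have "sum ?f {dim_col A..<dim_col A + dim_col B} = sum (\<lambda>l. ?f (l + dim_col A)) {0..<dim_col B}"
    using sum.shift_bounds_nat_ivl[of ?f 0 "dim_col A" "dim_col B"] by (simp add: add.commute)
  also have "sum ?f {0..<dim_col A} + \<dots> = (A * C + B * D) $$ (i, j)"
    using ij assms
    by (auto simp: index_append_cols index_append_rows scalar_prod_def intro!: arg_cong2[of _ _ _ _ "(+)"] sum.cong)
  finally show "((A @\<^sub>c B) * (C @\<^sub>r D)) $$ (i, j) = (A * C + B * D) $$ (i, j)" .
qed (use assms in auto)

lemma mat_adjoint_append_cols:
  "dim_row A = dim_row B \<Longrightarrow> (A @\<^sub>c B)\<^sup>\<dagger> = A\<^sup>\<dagger> @\<^sub>r B\<^sup>\<dagger>"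
  by (rule eq_matI) (auto simp: index_append_cols index_append_rows)

lemma four_block_one:
  "(1\<^sub>m a @\<^sub>c 0\<^sub>m a b) @\<^sub>r (0\<^sub>m b a @\<^sub>c 1\<^sub>m b) = 1\<^sub>m (a + b)"
  by (rule eq_matI) (auto simp: index_append_cols index_append_rows)

lemma append_cols_four_block:
  assumes "dim_row A = dim_row B" "dim_row C = dim_row D" "dim_col A = dim_col C" "dim_col B = dim_col D"
  shows "(A @\<^sub>c B) @\<^sub>r (C @\<^sub>c D) = four_block_mat A B C D"
  by (rule eq_matI) (use assms in \<open>auto simp: index_append_cols index_append_rows\<close>)

text \<open>\<open>M\<close> is kept general: the identity gives orthonormality of a joined family,
  the Minkowski metric gives Gram matrices, and \<open>A\<close> or \<open>B\<close> gives blocks in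
  an orthonormal basis.\<close>

lemma four_block_gram:
  fixes P V M :: "complex mat"
  assumes P: "P \<in> carrier_mat n a" and V: "V \<in> carrier_mat n b" and M: "M \<in> carrier_mat n n"
  shows "(P @\<^sub>c V)\<^sup>\<dagger> * M * (P @\<^sub>c V) =
    (P\<^sup>\<dagger> * M * P @\<^sub>c P\<^sup>\<dagger> * M * V) @\<^sub>r (V\<^sup>\<dagger> * M * P @\<^sub>c V\<^sup>\<dagger> * M * V)"
proof -
  have "(P @\<^sub>c V)\<^sup>\<dagger> * M * X = P\<^sup>\<dagger> * M * X @\<^sub>r V\<^sup>\<dagger> * M * X" if "dim_row X = n" for X
    using assms that by (simp add: mat_adjoint_append_cols append_rows_mult del: assoc_mult_mat)
  from this[of "P @\<^sub>c V"] show ?thesis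
    using assms by (simp add: mult_append_cols del: assoc_mult_mat)
qed

section \<open>Rank and orthonormal bases of column spaces\<close>

lemma mat_mult_unit_vec:
  fixes P :: "'a :: semiring_1 mat"
  assumes "P \<in> carrier_mat n r" "i < r"
  shows "P *\<^sub>v unit_vec r i = col P i"
  by (rule eq_vecI) (use assms in auto)

lemma left_invertible_inj:
  fixes P :: "'a :: field mat"
  assumes P: "P \<in> carrier_mat n r" and L: "L \<in> carrier_mat r n" and LP: "L * P = 1\<^sub>m r"
    and v: "v \<in> carrier_vec r" and Pv: "P *\<^sub>v v = 0\<^sub>v n"
  shows "v = 0\<^sub>v r"
proof -
  have "v = (L * P) *\<^sub>v v" using LP v by simp
  also have "\<dots> = L *\<^sub>v (P *\<^sub>v v)" using P L v by simp
  finally show ?thesis using Pv L by (auto intro!: eq_vecI)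
qed

text \<open>\<open>lin_indpt\<close> sees only the set of columns, so repeated columns are excluded
  separately. Both facts hold because a matrix with a left inverse has trivial kernel.\<close>

lemma (in vec_space) left_invertible_indpt:
  assumes P: "P \<in> carrier_mat n r" and L: "L \<in> carrier_mat r n" and LP: "L * P = 1\<^sub>m r"
  shows "distinct (cols P)" "lin_indpt (set (cols P))"
proof -
  show d: "distinct (cols P)"
    unfolding distinct_conv_nth
  proof (intro allI impI notI)
    fix i j assume ij: "i < length (cols P)" "j < length (cols P)" "i \<noteq> j" "cols P ! i = cols P ! j"
    then have ij': "i < r" "j < r" "col P i = col P j" using P by auto
    define v :: "'a vec" where "v = unit_vec r i - unit_vec r j"
    have "P *\<^sub>v v = col P i - col P j"
      using P ij' by (simp add: v_def mult_minus_distrib_mat_vec[OF P] mat_mult_unit_vec)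
    also have "\<dots> = 0\<^sub>v n" using P ij' by auto
    finally have "v = 0\<^sub>v r" by (intro left_invertible_inj[OF P L LP]) (auto simp: v_def)
    moreover have "v $ i = 1" using ij ij' by (simp add: v_def)
    ultimately show False using ij' by simp
  qed
  show "lin_indpt (set (cols P))"
    using lin_depE[OF P _ d] left_invertible_inj[OF P L LP] by metis
qed

lemma left_invertible_bound:
  fixes P :: "'a :: field mat"
  assumes P: "P \<in> carrier_mat n r" and L: "L \<in> carrier_mat r n" and LP: "L * P = 1\<^sub>m r"
  shows "r \<le> n"
proof -
  interpret vec_space "TYPE('a)" n .
  have "card (set (cols P)) \<le> dim"
    using left_invertible_indpt[OF P L LP] P cols_dim[of P] by (intro li_le_dim) auto
  then show ?thesis
    using left_invertible_indpt(1)[OF P L LP] P by (simp add: distinct_card dim_is_n)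
qed

text \<open>The right inverse makes \<open>W\<close> surjective, so \<open>P * W\<close> has the
  column space of \<open>P\<close>; the left inverse makes the \<open>r\<close> columns of
  \<open>P\<close> independent.\<close>

lemma (in vec_space) rank_full_factorization:
  assumes P: "P \<in> carrier_mat n r" and L: "L \<in> carrier_mat r n" and LP: "L * P = 1\<^sub>m r"
    and W: "W \<in> carrier_mat r m" and R: "R \<in> carrier_mat m r" and WR: "W * R = 1\<^sub>m r"
  shows "rank (P * W) = r"
proof -
  have "rank P = r"
    using lin_indpt_full_rank[OF P] left_invertible_indpt[OF P L LP] by simp
  moreover have "col_space (P * W) = col_space P"
  proof -
    have 1: "\<exists>y\<in>carrier_vec m. (P * W) *\<^sub>v y = P *\<^sub>v x" if x: "x \<in> carrier_vec r" for x
    proof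
      have "(P * W) *\<^sub>v (R *\<^sub>v x) = P *\<^sub>v ((W * R) *\<^sub>v x)" using P W R x by simp
      then show "(P * W) *\<^sub>v (R *\<^sub>v x) = P *\<^sub>v x" using WR x by simp
    qed (use R x in auto)
    have 2: "\<exists>x\<in>carrier_vec r. P *\<^sub>v x = (P * W) *\<^sub>v y" if "y \<in> carrier_vec m" for y
      using that P W by (intro bexI[of _ "W *\<^sub>v y"]) auto
    show ?thesis
      unfolding col_space_eq[OF P] col_space_eq[OF mult_carrier_mat[OF P W]]
      using 1 2 P W by (auto simp del: assoc_mult_mat_vec)
  qed
  ultimately show ?thesis by (simp add: rank_def col_space_def)
qed

text \<open>\<open>Q\<close> is an orthonormal basis of the column space of \<open>M\<close>; the existence of \<open>Z\<close> makes
  \<open>Q\<^sup>\<dagger> * M\<close> right invertible.\<close>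

definition range_basis :: "complex mat \<Rightarrow> nat \<Rightarrow> complex mat \<Rightarrow> bool" where
  "range_basis M r Q \<longleftrightarrow>
     Q \<in> carrier_mat (dim_row M) r \<and> Q\<^sup>\<dagger> * Q = 1\<^sub>m r \<and> Q * (Q\<^sup>\<dagger> * M) = M \<and>
     (\<exists>Z \<in> carrier_mat (dim_col M) r. Q = M * Z)"

text \<open>\<open>Q * (Q\<^sup>\<dagger> * M)\<close> is a full-rank factorization of
  \<open>M\<close>: the adjoint of \<open>Q\<close> is a left inverse of the first factor, and
  \<open>Z\<close> is a right inverse of the second.\<close>

lemma range_basis_rk:
  assumes "range_basis M r Q"
  shows "rk M = r"
proof -
  obtain Z where Z: "Z \<in> carrier_mat (dim_col M) r" and Q: "Q \<in> carrier_mat (dim_row M) r"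
    and QQ: "Q\<^sup>\<dagger> * Q = 1\<^sub>m r" and QM: "Q * (Q\<^sup>\<dagger> * M) = M" and QZ: "Q = M * Z"
    using assms unfolding range_basis_def by blast
  have "(Q\<^sup>\<dagger> * M) * Z = 1\<^sub>m r" using QQ QZ Q Z by (simp add: mat_assoc)
  then have "rk (Q * (Q\<^sup>\<dagger> * M)) = r"
    using vec_space.rank_full_factorization[OF Q _ QQ, of "Q\<^sup>\<dagger> * M" "dim_col M" Z] Q Z by auto
  then show ?thesis by (simp only: QM)
qed

text \<open>The scalar is the reciprocal of the Euclidean norm, which is positive because some entry
  is nonzero.\<close>

lemma normalized_column:
  fixes d :: "complex mat"
  assumes d: "d \<in> carrier_mat n 1" and d0: "d \<noteq> 0\<^sub>m n 1"
  shows "\<exists>c. (c \<cdot>\<^sub>m d)\<^sup>\<dagger> * (c \<cdot>\<^sub>m d) = 1\<^sub>m 1"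
proof -
  define S where "S = (\<Sum>i<n. (cmod (d $$ (i, 0)))\<^sup>2)"
  obtain i where i: "i < n" "d $$ (i, 0) \<noteq> 0"
    using d d0 by (auto simp: mat_eq_iff)
  have "0 < (cmod (d $$ (i, 0)))\<^sup>2" using i by simp
  also have "\<dots> \<le> S" unfolding S_def using i by (intro member_le_sum) auto
  finally have "S > 0" .
  define c where "c = complex_of_real (1 / sqrt S)"
  have c: "cnj c * c = complex_of_real (1 / S)"
    using \<open>S > 0\<close> by (simp add: c_def flip: of_real_mult)
  have "((c \<cdot>\<^sub>m d)\<^sup>\<dagger> * (c \<cdot>\<^sub>m d)) $$ (0, 0) = (\<Sum>i<n. (cnj c * c) * (cnj (d $$ (i, 0)) * d $$ (i, 0)))"
    using d by (auto simp: scalar_prod_def atLeast0LessThan intro!: sum.cong)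
  also have "\<dots> = (cnj c * c) * (\<Sum>i<n. complex_of_real ((cmod (d $$ (i, 0)))\<^sup>2))"
    by (simp only: sum_distrib_left complex_norm_square mult.commute)
  also have "(\<Sum>i<n. complex_of_real ((cmod (d $$ (i, 0)))\<^sup>2)) = complex_of_real S"
    by (simp add: S_def)
  also have "cnj c * c * complex_of_real S = 1"
    using \<open>S > 0\<close> unfolding c by (simp flip: of_real_mult)
  finally show ?thesis
    using d by (intro exI[of _ c] eq_matI) auto
qed

lemma range_basis_exists:
  fixes M :: "complex mat"
  shows "\<exists>r Q. range_basis M r Q"
proof -
  \<comment> \<open>Take a largest orthonormal family in the column space: if it did not span, a nonzero column of
    \<open>M - Q * (Q\<^sup>\<dagger> * M)\<close> could be normalized and appended.\<close>
  let ?n = "dim_row M" and ?m = "dim_col M"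
  define ok where "ok r Q Z \<longleftrightarrow> Q \<in> carrier_mat ?n r \<and> Z \<in> carrier_mat ?m r \<and>
    Q\<^sup>\<dagger> * Q = 1\<^sub>m r \<and> Q = M * Z" for r Q Z
  define R where "R = {r. \<exists>Q Z. ok r Q Z}"
  have "ok 0 (0\<^sub>m ?n 0) (0\<^sub>m ?m 0)" by (auto simp: ok_def)
  then have "R \<noteq> {}" by (auto simp: R_def)
  have "r \<le> ?n" if "ok r Q Z" for r Q Z
    using that left_invertible_bound[of Q ?n r "Q\<^sup>\<dagger>"] by (auto simp: ok_def)
  then have "R \<subseteq> {..?n}" by (auto simp: R_def)
  then have fin: "finite R" using finite_subset by blast
  define r where "r = Max R"
  have max: "r' \<le> r" if "ok r' Q Z" for r' Q Z
    using that fin by (auto simp: r_def R_def intro!: Max_ge)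
  have "r \<in> R" using Max_in[OF fin \<open>R \<noteq> {}\<close>] by (simp add: r_def)
  then obtain Q Z where "ok r Q Z" by (auto simp: R_def)
  then have Q: "Q \<in> carrier_mat ?n r" and Z: "Z \<in> carrier_mat ?m r" and QQ: "Q\<^sup>\<dagger> * Q = 1\<^sub>m r"
    and QZ: "Q = M * Z" by (auto simp: ok_def)
  have M: "M \<in> carrier_mat ?n ?m" by simp
  \<comment> \<open>Since \<open>Q = M * Z\<close>, the residual of the projection of
    \<open>M\<close> equals \<open>M * ?F\<close>, so its columns stay in the column space of
    \<open>M\<close>.\<close>
  let ?F = "1\<^sub>m ?m - Z * (Q\<^sup>\<dagger> * M)"
  have F: "?F \<in> carrier_mat ?m ?m" using Z Q by auto
  have MF: "M * ?F = M - Q * (Q\<^sup>\<dagger> * M)"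
  proof -
    have "M * ?F = M * 1\<^sub>m ?m - M * (Z * (Q\<^sup>\<dagger> * M))"
      using Z Q by (intro mult_minus_distrib_mat) auto
    also have "M * (Z * (Q\<^sup>\<dagger> * M)) = (M * Z) * (Q\<^sup>\<dagger> * M)" using Z Q by (simp add: mat_assoc)
    finally show ?thesis by (simp flip: QZ)
  qed
  have QMF: "Q\<^sup>\<dagger> * (M * ?F) = 0\<^sub>m r ?m"
  proof -
    have "Q\<^sup>\<dagger> * (M * ?F) = Q\<^sup>\<dagger> * M - Q\<^sup>\<dagger> * (Q * (Q\<^sup>\<dagger> * M))"
      unfolding MF using Q by (intro mult_minus_distrib_mat) auto
    also have "Q\<^sup>\<dagger> * (Q * (Q\<^sup>\<dagger> * M)) = Q\<^sup>\<dagger> * M"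
      using Q QQ by (simp add: left_mult_one_mat' flip: mat_assoc)
    finally show ?thesis using Q by auto
  qed
  have "M * ?F = 0\<^sub>m ?n ?m"
  proof (rule ccontr)
    assume "M * ?F \<noteq> 0\<^sub>m ?n ?m"
    then obtain i j where ij: "i < ?n" "j < ?m" "(M * ?F) $$ (i, j) \<noteq> 0"
      using F by (auto simp: mat_eq_iff simp del: index_mult_mat(1))
    \<comment> \<open>\<open>e\<close> is the \<open>j\<close>-th unit vector as a one-column
      matrix; \<open>M * ?F * e\<close> is then a nonzero column of the residual, orthogonal to
      \<open>Q\<close>.\<close>
    define e :: "complex mat" where "e = mat ?m 1 (\<lambda>(i, _). if i = j then 1 else 0)"
    have e: "e \<in> carrier_mat ?m 1" by (simp add: e_def)
    have Xe: "(X * e) $$ (a, 0) = X $$ (a, j)" if "X \<in> carrier_mat p ?m" "a < p" for X a p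
    proof -
      have "(X * e) $$ (a, 0) = (\<Sum>i = 0..<?m. X $$ (a, i) * (if i = j then 1 else 0))"
        using that by (auto simp: e_def scalar_prod_def intro!: sum.cong)
      then show ?thesis using ij by (simp add: if_distrib cong: if_cong)
    qed
    let ?d = "M * ?F * e"
    have d: "?d \<in> carrier_mat ?n 1" using F e by auto
    have "?d $$ (i, 0) \<noteq> 0" using Xe[OF mult_carrier_mat[OF M F] ij(1)] ij(3) by simp
    then have "?d \<noteq> 0\<^sub>m ?n 1" using ij by (auto simp del: index_mult_mat(1))
    then obtain c where c: "(c \<cdot>\<^sub>m ?d)\<^sup>\<dagger> * (c \<cdot>\<^sub>m ?d) = 1\<^sub>m 1"
      using normalized_column[OF d] by blast
    let ?v = "c \<cdot>\<^sub>m ?d"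
    have v: "?v \<in> carrier_mat ?n 1" using d by auto
    have Qv: "Q\<^sup>\<dagger> * ?v = 0\<^sub>m r 1"
    proof -
      have "Q\<^sup>\<dagger> * ?d = (Q\<^sup>\<dagger> * (M * ?F)) * e"
        using Q F e by (simp add: mat_assoc)
      then have "Q\<^sup>\<dagger> * ?d = 0\<^sub>m r 1" using e by (simp add: QMF)
      moreover have "Q\<^sup>\<dagger> * ?v = c \<cdot>\<^sub>m (Q\<^sup>\<dagger> * ?d)" using Q d by (intro mult_smult_distrib) auto
      ultimately show ?thesis by simp
    qed
    have vQ: "?v\<^sup>\<dagger> * Q = 0\<^sub>m 1 r"
    proof -
      have "(Q\<^sup>\<dagger> * ?v)\<^sup>\<dagger> = ?v\<^sup>\<dagger> * Q" using Q v by (subst mat_adjoint_mult) auto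
      then show ?thesis by (simp only: Qv mat_adjoint_zero)
    qed
    have "(Q @\<^sub>c ?v)\<^sup>\<dagger> * 1\<^sub>m ?n * (Q @\<^sub>c ?v) = 1\<^sub>m (r + 1)"
      using four_block_gram[OF Q v one_carrier_mat] Q v
      by (simp add: QQ Qv vQ c four_block_one right_mult_one_mat')
    then have "(Q @\<^sub>c ?v)\<^sup>\<dagger> * (Q @\<^sub>c ?v) = 1\<^sub>m (r + 1)" using Q by (simp add: right_mult_one_mat')
    moreover have "Q @\<^sub>c ?v = M * (Z @\<^sub>c c \<cdot>\<^sub>m (?F * e))"
    proof -
      have "M * (c \<cdot>\<^sub>m (?F * e)) = c \<cdot>\<^sub>m (M * (?F * e))" 
        by (rule mult_smult_distrib[OF M mult_carrier_mat[OF F e]])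
      also have "M * (?F * e) = ?d" using assoc_mult_mat[OF M F e] by simp
      finally have "M * (c \<cdot>\<^sub>m (?F * e)) = ?v" .
      then show ?thesis using Z F e QZ by (simp add: mult_append_cols)
    qed
    ultimately have "ok (r + 1) (Q @\<^sub>c ?v) (Z @\<^sub>c c \<cdot>\<^sub>m (?F * e))"
      using Q v Z F e unfolding ok_def by (intro conjI append_cols_carrier) auto
    then show False using max by fastforce
  qed
  then have "M - Q * (Q\<^sup>\<dagger> * M) = 0\<^sub>m ?n ?m" using MF by simp
  then have "Q * (Q\<^sup>\<dagger> * M) = M"
    using Q by (intro eq_matI) (auto simp: mat_eq_iff simp del: index_mult_mat(1))
  then show ?thesis using Q Z QQ QZ unfolding range_basis_def by blast
qed

lemma range_basisE:
  assumes "range_basis M r Q" and M: "M \<in> carrier_mat n m"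
  obtains Z where "Q \<in> carrier_mat n r" "Q\<^sup>\<dagger> * Q = 1\<^sub>m r" "Q * (Q\<^sup>\<dagger> * M) = M"
    "Z \<in> carrier_mat m r" "Q = M * Z"
  using assms(1) unfolding range_basis_def carrier_matD[OF M] by blast

lemma orthonormal_completion:
  fixes Q :: "complex mat"
  assumes Q: "Q \<in> carrier_mat n r" and QQ: "Q\<^sup>\<dagger> * Q = 1\<^sub>m r"
  shows "\<exists>V \<in> carrier_mat n (n - r). V\<^sup>\<dagger> * V = 1\<^sub>m (n - r) \<and> Q\<^sup>\<dagger> * V = 0\<^sub>m r (n - r) \<and>
    V\<^sup>\<dagger> * Q = 0\<^sub>m (n - r) r \<and> Q * Q\<^sup>\<dagger> + V * V\<^sup>\<dagger> = 1\<^sub>m n"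
proof -
  have Q' [simp]: "dim_row Q = n" "dim_col Q = r" using Q by auto
  let ?D = "1\<^sub>m n - Q * Q\<^sup>\<dagger>"
  have D: "?D \<in> carrier_mat n n" using Q by auto
  \<comment> \<open>\<open>?D\<close> is the orthogonal projection onto the complement of the column space of \<open>Q\<close>.\<close>
  obtain q V where "range_basis ?D q V" using range_basis_exists by blast
  then obtain Z where V: "V \<in> carrier_mat n q" and VV: "V\<^sup>\<dagger> * V = 1\<^sub>m q"
    and VD: "V * (V\<^sup>\<dagger> * ?D) = ?D" and Z: "Z \<in> carrier_mat n q" and DZ: "V = ?D * Z"
    using D by (rule range_basisE)
  have [simp]: "dim_row V = n" "dim_col V = q" "dim_row Z = n" using V Z by auto
  have "Q\<^sup>\<dagger> * ?D = Q\<^sup>\<dagger> * 1\<^sub>m n - Q\<^sup>\<dagger> * (Q * Q\<^sup>\<dagger>)" using Q by (intro mult_minus_distrib_mat) auto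
  also have "Q\<^sup>\<dagger> * (Q * Q\<^sup>\<dagger>) = Q\<^sup>\<dagger>" by (simp add: QQ left_mult_one_mat' flip: mat_assoc)
  finally have "Q\<^sup>\<dagger> * ?D = 0\<^sub>m r n" by (auto simp: right_mult_one_mat')
  moreover have "Q\<^sup>\<dagger> * V = Q\<^sup>\<dagger> * ?D * Z" by (subst DZ) (simp add: mat_assoc)
  ultimately have QV: "Q\<^sup>\<dagger> * V = 0\<^sub>m r q" using Z by simp
  have "V\<^sup>\<dagger> * Q = (Q\<^sup>\<dagger> * V)\<^sup>\<dagger>" by (simp add: mat_adjoint_mult)
  then have VQ: "V\<^sup>\<dagger> * Q = 0\<^sub>m q r" by (simp only: QV mat_adjoint_zero)
  have "V\<^sup>\<dagger> * ?D = V\<^sup>\<dagger> * 1\<^sub>m n - V\<^sup>\<dagger> * (Q * Q\<^sup>\<dagger>)"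
    by (rule mult_minus_distrib_mat[of _ q n _ n]; intro carrier_matI; simp)
  also have "V\<^sup>\<dagger> * (Q * Q\<^sup>\<dagger>) = 0\<^sub>m q n" using Q by (simp add: VQ flip: mat_assoc)
  \<comment> \<open>As \<open>V\<close> is orthogonal to \<open>Q\<close>, the projection
    \<open>?D\<close> fixes it, and \<open>VD\<close> becomes
    \<open>V * V\<^sup>\<dagger> = ?D\<close>.\<close>
  finally have "V\<^sup>\<dagger> * ?D = V\<^sup>\<dagger>"
    using V by (auto simp: right_mult_one_mat' intro!: eq_matI)
  then have "V * V\<^sup>\<dagger> = ?D" using VD by simp
  then have sum: "Q * Q\<^sup>\<dagger> + V * V\<^sup>\<dagger> = 1\<^sub>m n" by (auto intro!: eq_matI)
  let ?U = "Q @\<^sub>c V"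
  have U: "?U \<in> carrier_mat n (r + q)" using Q V by simp
  have "?U\<^sup>\<dagger> * 1\<^sub>m n * ?U = 1\<^sub>m (r + q)"
    using four_block_gram[OF Q V one_carrier_mat] by (simp add: QQ QV VQ VV four_block_one right_mult_one_mat')
  then have "?U\<^sup>\<dagger> * ?U = 1\<^sub>m (r + q)" by (simp add: right_mult_one_mat')
  \<comment> \<open>The size \<open>q\<close> is found by counting: \<open>?U\<close> and its
    adjoint are each a left inverse of the other, which gives both inequalities.\<close>
  then have "r + q \<le> n" using left_invertible_bound[OF U, of "?U\<^sup>\<dagger>"] U by simp
  moreover have "?U * ?U\<^sup>\<dagger> = 1\<^sub>m n"
    by (simp add: mat_adjoint_append_cols append_cols_mult_append_rows sum)
  then have "n \<le> r + q" using left_invertible_bound[of "?U\<^sup>\<dagger>" "r + q" n ?U] U by simp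
  ultimately have "q = n - r" by simp
  then show ?thesis using V VV QV VQ sum by blast
qed

text \<open>An orthonormal basis \<open>Q\<close> of the column space of \<open>T\<close> splits the
  product as \<open>(P * Q) * (Q\<^sup>\<dagger> * T * W)\<close>. The first factor has a left
  inverse and the second a right inverse, so the rank is the number of columns of
  \<open>Q\<close>.\<close>

lemma rk_sandwich:
  fixes T :: "complex mat"
  assumes T: "T \<in> carrier_mat a b"
    and P: "P \<in> carrier_mat n a" and L: "L \<in> carrier_mat a n" and LP: "L * P = 1\<^sub>m a"
    and W: "W \<in> carrier_mat b m" and R: "R \<in> carrier_mat m b" and WR: "W * R = 1\<^sub>m b"
  shows "rk (P * (T * W)) = rk T"
proof -
  obtain r Q where rb: "range_basis T r Q" using range_basis_exists by blast
  then obtain Z where Q: "Q \<in> carrier_mat a r" and QQ: "Q\<^sup>\<dagger> * Q = 1\<^sub>m r"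
    and QT: "Q * (Q\<^sup>\<dagger> * T) = T" and Z: "Z \<in> carrier_mat b r" and TZ: "Q = T * Z"
    using T by (rule range_basisE)
  note [simp] = carrier_matD[OF T] carrier_matD[OF P] carrier_matD[OF L] carrier_matD[OF W]
    carrier_matD[OF R] carrier_matD[OF Q] carrier_matD[OF Z]
  have "Q\<^sup>\<dagger> * L * (P * Q) = Q\<^sup>\<dagger> * ((L * P) * Q)" by (simp add: mat_assoc)
  also have "\<dots> = 1\<^sub>m r" by (simp add: LP QQ left_mult_one_mat')
  finally have left: "Q\<^sup>\<dagger> * L * (P * Q) = 1\<^sub>m r" .
  have "Q\<^sup>\<dagger> * T * W * (R * Z) = Q\<^sup>\<dagger> * (T * ((W * R) * Z))" by (simp add: mat_assoc)
  also have "\<dots> = 1\<^sub>m r" using TZ QQ by (simp add: WR left_mult_one_mat')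
  finally have right: "Q\<^sup>\<dagger> * T * W * (R * Z) = 1\<^sub>m r" .
  have "vec_space.rank n (P * Q * (Q\<^sup>\<dagger> * T * W)) = r"
    by (rule vec_space.rank_full_factorization[OF _ _ left _ _ right, of _ m]; intro carrier_matI; simp)
  moreover have "P * Q * (Q\<^sup>\<dagger> * T * W) = P * (Q * (Q\<^sup>\<dagger> * T) * W)" by (simp add: mat_assoc)
  ultimately show ?thesis using range_basis_rk[OF rb] by (simp add: QT)
qed

section \<open>Rank bounds and invertibility at full rank\<close>

lemma rk_le_dim_row: "rk M \<le> dim_row M"
proof -
  obtain r Q where rb: "range_basis M r Q" using range_basis_exists by blast
  then show ?thesis
    using left_invertible_bound[of Q "dim_row M" r "Q\<^sup>\<dagger>"] range_basis_rk[OF rb]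
    unfolding range_basis_def by simp
qed

lemma rk_mult_le:
  fixes X Y :: "complex mat"
  assumes XY: "dim_col X = dim_row Y"
  shows "rk (X * Y) \<le> rk X"
proof -
  obtain r Q where rb: "range_basis X r Q" using range_basis_exists by blast
  then have Q: "Q \<in> carrier_mat (dim_row X) r" and QQ: "Q\<^sup>\<dagger> * Q = 1\<^sub>m r" and QX: "Q * (Q\<^sup>\<dagger> * X) = X"
    unfolding range_basis_def by blast+
  note [simp] = carrier_matD[OF Q]
  let ?W = "Q\<^sup>\<dagger> * X * Y"
  have W: "?W \<in> carrier_mat r (dim_col Y)" by (intro carrier_matI) auto
  \<comment> \<open>The identity factor gives the product the shape required by
    \<open>rk_sandwich\<close>; the middle factor \<open>?W\<close> has only \<open>r\<close>
    rows.\<close>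
  have "Q * (?W * 1\<^sub>m (dim_col Y)) = Q * (Q\<^sup>\<dagger> * X) * Y"
    using XY by (simp add: mat_assoc right_mult_one_mat')
  then have "rk (X * Y) = rk (Q * (?W * 1\<^sub>m (dim_col Y)))" using QX by simp
  also have "\<dots> = rk ?W"
    by (rule rk_sandwich[OF W Q _ QQ one_carrier_mat one_carrier_mat]) (use Q in auto)
  also have "\<dots> \<le> r" using rk_le_dim_row[of ?W] by simp
  finally show ?thesis using range_basis_rk[OF rb] by simp
qed

lemma full_rk_inverse:
  assumes T: "T \<in> carrier_mat r r" and rk: "rk T = r"
  shows "\<exists>T' \<in> carrier_mat r r. T * T' = 1\<^sub>m r \<and> T' * T = 1\<^sub>m r"
proof -
  have "det T \<noteq> 0" using vec_space.det_rank_iff[OF T] T rk by simp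
  from det_non_zero_imp_unit[OF T this, of undefined] show ?thesis
    by (auto simp: Units_def ring_mat_def)
qed

section \<open>The index and the core part\<close>

text \<open>\<open>LEAST\<close> has its defining property only once some exponent satisfies it.
  Otherwise the rank would drop at every step from exponent 1 on, an infinite descent.\<close>

lemma mat_index_stable:
  assumes A: "A \<in> carrier_mat n n"
  shows "rk (A ^\<^sub>m (mat_index A + 1)) = rk (A ^\<^sub>m mat_index A)"
proof -
  let ?f = "\<lambda>k. rk (A ^\<^sub>m k)"
  have "\<exists>k. 0 < k \<and> ?f (k + 1) = ?f k"
  proof (rule ccontr)
    assume none: "\<not> ?thesis"
    have dec: "?f (Suc k) < ?f k" if "0 < k" for k
    proof -
      have "?f (Suc k) \<le> ?f k" using rk_mult_le[of "A ^\<^sub>m k" A] A by simp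
      then show ?thesis using none that by (metis Suc_eq_plus1 le_neq_implies_less)
    qed
    \<comment> \<open>Here \<open>k\<close> counts the strict drops, starting at exponent 1 because
      the index is positive; more than \<open>?f 1\<close> drops are impossible.\<close>
    have "?f (Suc k) + k \<le> ?f 1" for k
    proof (induction k)
      case (Suc k)
      then show ?case using dec[of "Suc k"] by linarith
    qed simp
    from this[of "Suc (?f 1)"] show False by simp
  qed
  from LeastI_ex[OF this] show ?thesis unfolding mat_index_def by simp
qed

lemma pow_mat_commute:
  assumes A: "A \<in> carrier_mat n n"
  shows "A * A ^\<^sub>m k = A ^\<^sub>m k * A"
proof (induction k)
  case (Suc k)
  have "A * A ^\<^sub>m Suc k = A * A ^\<^sub>m k * A" using A by (simp add: mat_assoc)
  then show ?case using Suc by simp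
qed (use A in simp)

text \<open>\<open>A\<close> commutes with its powers, so it maps the range of each power into
  itself. Stability of the rank at the index makes the restriction invertible, and \<open>T\<close>
  is its matrix in the basis \<open>P\<close>.\<close>

lemma core_restriction:
  assumes A: "A \<in> carrier_mat n n" and rb: "range_basis (A ^\<^sub>m mat_index A) r P"
  shows "\<exists>T \<in> carrier_mat r r. \<exists>T' \<in> carrier_mat r r.
    A * P = P * T \<and> T * T' = 1\<^sub>m r \<and> T' * T = 1\<^sub>m r"
proof -
  let ?M = "A ^\<^sub>m mat_index A"
  have M: "?M \<in> carrier_mat n n" using A by simp
  obtain Z where P: "P \<in> carrier_mat n r" and PP: "P\<^sup>\<dagger> * P = 1\<^sub>m r"
    and PM: "P * (P\<^sup>\<dagger> * ?M) = ?M" and Z: "Z \<in> carrier_mat n r" and MZ: "P = ?M * Z"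
    by (rule range_basisE[OF rb M])
  note [simp] = carrier_matD[OF A] carrier_matD[OF M] carrier_matD[OF P] carrier_matD[OF Z]
  \<comment> \<open>\<open>?T\<close> is \<open>P\<^sup>\<dagger> * A * P\<close> rewritten: with
    \<open>P = ?M * Z\<close>, the power \<open>?M\<close> is moved to the left of \<open>A\<close>,
    where the projection onto its range absorbs it.\<close>
  let ?W = "P\<^sup>\<dagger> * ?M" and ?T = "P\<^sup>\<dagger> * ?M * A * Z"
  have W: "?W \<in> carrier_mat r n" and T: "?T \<in> carrier_mat r r" by (intro carrier_matI; simp)+
  have WZ: "?W * Z = 1\<^sub>m r" using PP MZ by (simp add: mat_assoc)
  have "A * P = A * ?M * Z" by (subst MZ) (simp add: mat_assoc)
  also have "\<dots> = P * (P\<^sup>\<dagger> * ?M) * A * Z" by (simp only: pow_mat_commute[OF A] PM)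
  also have "\<dots> = P * ?T" by (simp add: mat_assoc)
  finally have AP: "A * P = P * ?T" .
  have "A ^\<^sub>m (mat_index A + 1) = A * (P * ?W)" by (simp add: pow_mat_commute[OF A] PM)
  also have "\<dots> = A * P * ?W" by (simp add: mat_assoc)
  also have "\<dots> = P * (?T * ?W)" unfolding AP by (simp add: mat_assoc)
  finally have "rk (A ^\<^sub>m (mat_index A + 1)) = rk (P * (?T * ?W))" by simp
  also have "\<dots> = rk ?T" by (rule rk_sandwich[OF T P _ PP W Z WZ]) (use P in auto)
  finally have "rk ?T = r" using mat_index_stable[OF A] range_basis_rk[OF rb] by simp
  then show ?thesis using full_rk_inverse[OF T] T AP by blast
qed

section \<open>The core-EP inverse for the Minkowski metric\<close>

lemma minkowski_metric_carrier [simp]: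
  "1 \<le> n \<Longrightarrow> minkowski_metric n \<in> carrier_mat n n"
  unfolding minkowski_metric_def by (intro carrier_matI) auto

lemma minkowski_metric_adjoint: "(minkowski_metric n)\<^sup>\<dagger> = minkowski_metric n"
  unfolding minkowski_metric_def by (rule eq_matI) auto

lemma minkowski_metric_square:
  assumes "1 \<le> n"
  shows "minkowski_metric n * minkowski_metric n = 1\<^sub>m n"
proof -
  have [simp]: "- 0\<^sub>m a b = (0\<^sub>m a b :: complex mat)" for a b by (rule eq_matI) auto
  show ?thesis
    unfolding minkowski_metric_def
    by (subst mult_four_block_mat[of _ 1 1 _ "n - 1" _ "n - 1" _ _ 1 _ "n - 1"]) (use assms in auto)
qed

text \<open>With \<open>?W\<close> the adjoint of \<open>P\<close> times \<open>M\<close>, the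
  product in \<open>rk\<close> is \<open>(?G * ?W\<^sup>\<dagger>) * (G1 * ?W)\<close>. The factors
  around \<open>G1\<close> are one-sidedly invertible, so the rank condition says that
  \<open>G1\<close> has full rank.\<close>

lemma gram_inverse:
  assumes n: "1 \<le> n" and M: "M \<in> carrier_mat n n" and rb: "range_basis M r P"
    and rk: "rk (minkowski_adjoint M * M) = r"
  defines "G1 \<equiv> P\<^sup>\<dagger> * minkowski_metric n * P"
  shows "\<exists>G1' \<in> carrier_mat r r. G1 * G1' = 1\<^sub>m r \<and> G1' * G1 = 1\<^sub>m r"
proof -
  let ?G = "minkowski_metric n"
  obtain Z where P: "P \<in> carrier_mat n r" and PP: "P\<^sup>\<dagger> * P = 1\<^sub>m r"
    and PM: "P * (P\<^sup>\<dagger> * M) = M" and Z: "Z \<in> carrier_mat n r" and MZ: "P = M * Z"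
    by (rule range_basisE[OF rb M])
  have G: "?G \<in> carrier_mat n n" using n by simp
  note [simp] = carrier_matD[OF M] carrier_matD[OF P] carrier_matD[OF Z] carrier_matD[OF G]
  let ?W = "P\<^sup>\<dagger> * M"
  have W: "?W \<in> carrier_mat r n" and G1: "G1 \<in> carrier_mat r r"
    unfolding G1_def by (intro carrier_matI; simp)+
  have WZ: "?W * Z = 1\<^sub>m r" using PP MZ by (simp add: mat_assoc)
  have ZW: "Z\<^sup>\<dagger> * ?W\<^sup>\<dagger> = 1\<^sub>m r"
    using arg_cong[OF WZ, of mat_adjoint] by (simp add: mat_adjoint_mult mat_assoc)
  have "M\<^sup>\<dagger> = ?W\<^sup>\<dagger> * P\<^sup>\<dagger>"
    using arg_cong[OF PM, of mat_adjoint] by (simp add: mat_adjoint_mult mat_assoc)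
  then have "minkowski_adjoint M * M = ?G * (?W\<^sup>\<dagger> * P\<^sup>\<dagger>) * ?G * (P * ?W)"
    unfolding minkowski_adjoint_def PM by simp
  also have "\<dots> = ?G * ?W\<^sup>\<dagger> * (G1 * ?W)"
    unfolding G1_def by (simp add: mat_assoc)
  finally have "r = rk (?G * ?W\<^sup>\<dagger> * (G1 * ?W))" using rk by simp
  also have "\<dots> = rk G1"
  proof (rule rk_sandwich[OF G1 _ _ _ W Z WZ])
    \<comment> \<open>A left inverse of \<open>?G * ?W\<^sup>\<dagger>\<close> is available because
      the metric squares to the identity and \<open>ZW\<close> is the adjoint of
      \<open>WZ\<close>.\<close>
    have "Z\<^sup>\<dagger> * ?G * (?G * ?W\<^sup>\<dagger>) = Z\<^sup>\<dagger> * ((?G * ?G) * ?W\<^sup>\<dagger>)" by (simp add: mat_assoc)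
    also have "\<dots> = 1\<^sub>m r" using ZW by (simp add: minkowski_metric_square[OF n] left_mult_one_mat')
    finally show "Z\<^sup>\<dagger> * ?G * (?G * ?W\<^sup>\<dagger>) = 1\<^sub>m r" .
  qed (intro carrier_matI; simp)+
  finally show ?thesis using full_rk_inverse[OF G1] by simp
qed

text \<open>\<open>P * P\<^sup>\<dagger>\<close> is the orthogonal projection onto the column space
  of \<open>M\<close>. The range condition in the definition of the inverse thus becomes an
  equation.\<close>

lemma column_space_subset_iff:
  assumes M: "M \<in> carrier_mat n n" and rb: "range_basis M r P" and X: "X \<in> carrier_mat n n"
  shows "column_space X \<subseteq> column_space M \<longleftrightarrow> P * (P\<^sup>\<dagger> * X) = X"
proof -
  interpret vec_space "TYPE(complex)" n .
  obtain Z where P: "P \<in> carrier_mat n r" and PM: "P * (P\<^sup>\<dagger> * M) = M"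
    and Z: "Z \<in> carrier_mat n r" and MZ: "P = M * Z"
    by (rule range_basisE[OF rb M])
  have P': "P\<^sup>\<dagger> \<in> carrier_mat r n" using P by simp
  note [simp] = carrier_matD[OF M] carrier_matD[OF P] carrier_matD[OF Z] carrier_matD[OF X]
  show ?thesis
  proof
    assume sub: "column_space X \<subseteq> column_space M"
    show "P * (P\<^sup>\<dagger> * X) = X"
    proof (rule mat_col_eqI)
      fix j assume "j < dim_col X"
      then have j: "j < n" by simp
      have "col X j \<in> column_space X"
        using j X mat_mult_unit_vec[OF X, of j]
        by (auto simp: col_space_eq[OF X] intro!: bexI[of _ "unit_vec n j"] col_carrier_vec)
      with sub obtain y where y: "y \<in> carrier_vec n" "M *\<^sub>v y = col X j"
        by (auto simp: col_space_eq[OF M])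
      have "col (P * (P\<^sup>\<dagger> * X)) j = P *\<^sub>v (P\<^sup>\<dagger> *\<^sub>v col X j)"
        using col_mult2[OF P mult_carrier_mat[OF P' X] j] col_mult2[OF P' X j] by simp
      also have "\<dots> = (P * (P\<^sup>\<dagger> * M)) *\<^sub>v y"
        using assoc_mult_mat_vec[OF P mult_carrier_mat[OF P' M] y(1)] assoc_mult_mat_vec[OF P' M y(1)]
        by (simp add: y(2))
      finally show "col (P * (P\<^sup>\<dagger> * X)) j = col X j" using PM y(2) by simp
    qed auto
  next
    assume eq: "P * (P\<^sup>\<dagger> * X) = X"
    let ?Y = "Z * (P\<^sup>\<dagger> * X)"
    have Y: "?Y \<in> carrier_mat n n" by (intro carrier_matI) auto
    have "M * ?Y = (M * Z) * (P\<^sup>\<dagger> * X)" by (simp add: mat_assoc)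
    then have MY: "X = M * ?Y" using eq MZ by simp
    have "X *\<^sub>v x = M *\<^sub>v (?Y *\<^sub>v x)" if "x \<in> carrier_vec n" for x
      using assoc_mult_mat_vec[OF M Y that] MY by simp
    then show "column_space X \<subseteq> column_space M"
      using Y by (auto simp: col_space_eq[OF X] col_space_eq[OF M] intro!: mult_mat_vec_carrier)
  qed
qed

text \<open>Existence, uniqueness and the closed form at once. For an inverse
  \<open>X = P * Y\<close>, the power equation forces \<open>Y * P = T'\<close>; self-adjointness of
  \<open>A * X = P * (T * Y)\<close> then determines \<open>T * Y\<close>. Conversely, the formula
  is checked against each condition.\<close>

lemma is_m_core_EP_inverse_iff:
  assumes n: "1 \<le> n" and A: "A \<in> carrier_mat n n"
    and rb: "range_basis (A ^\<^sub>m mat_index A) r P"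
    and T: "T \<in> carrier_mat r r" and T': "T' \<in> carrier_mat r r" and AP: "A * P = P * T"
    and TT': "T * T' = 1\<^sub>m r" and T'T: "T' * T = 1\<^sub>m r"
    and G': "G1' \<in> carrier_mat r r"
    and GG': "P\<^sup>\<dagger> * minkowski_metric n * P * G1' = 1\<^sub>m r"
    and G'G: "G1' * (P\<^sup>\<dagger> * minkowski_metric n * P) = 1\<^sub>m r"
  shows "is_m_core_EP_inverse A X \<longleftrightarrow> X = P * (T' * (G1' * (P\<^sup>\<dagger> * minkowski_metric n)))"
proof -
  let ?M = "A ^\<^sub>m mat_index A" and ?G = "minkowski_metric n"
  have M: "?M \<in> carrier_mat n n" using A by simp
  obtain Z where P: "P \<in> carrier_mat n r" and PP: "P\<^sup>\<dagger> * P = 1\<^sub>m r"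
    and PM: "P * (P\<^sup>\<dagger> * ?M) = ?M" and Z: "Z \<in> carrier_mat n r" and MZ: "P = ?M * Z"
    by (rule range_basisE[OF rb M])
  have G: "?G \<in> carrier_mat n n" using n by simp
  note [simp] = carrier_matD[OF A] carrier_matD[OF M] carrier_matD[OF P] carrier_matD[OF Z]
    carrier_matD[OF G] carrier_matD[OF T] carrier_matD[OF T'] carrier_matD[OF G']
  have GG: "?G * (?G * Y) = Y" if "dim_row Y = n" for Y
    using that by (simp add: minkowski_metric_square[OF n] left_mult_one_mat' flip: mat_assoc)
  \<comment> \<open>Products are kept nested to the right, so each inverse pair is cancelled in
    front of an arbitrary factor \<open>Y\<close>.\<close>
  have cancel: "P\<^sup>\<dagger> * (P * Y) = Y" "T * (T' * Y) = Y" "T' * (T * Y) = Y"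
    "G1' * (P\<^sup>\<dagger> * (?G * (P * Y))) = Y" "P\<^sup>\<dagger> * (?G * (P * (G1' * Y))) = Y"
    if "dim_row Y = r" for Y
  proof -
    show "P\<^sup>\<dagger> * (P * Y) = Y" "T * (T' * Y) = Y" "T' * (T * Y) = Y"
      using that by (simp_all add: PP TT' T'T left_mult_one_mat' flip: mat_assoc)
    have "(G1' * (P\<^sup>\<dagger> * ?G * P)) * Y = G1' * (P\<^sup>\<dagger> * (?G * (P * Y)))"
      using that by (simp add: mat_assoc)
    then show "G1' * (P\<^sup>\<dagger> * (?G * (P * Y))) = Y" using that by (simp add: G'G left_mult_one_mat')
    have "(P\<^sup>\<dagger> * ?G * P * G1') * Y = P\<^sup>\<dagger> * (?G * (P * (G1' * Y)))"
      using that by (simp add: mat_assoc)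
    then show "P\<^sup>\<dagger> * (?G * (P * (G1' * Y))) = Y" using that by (simp add: GG' left_mult_one_mat')
  qed
  have pow: "A ^\<^sub>m (mat_index A + 1) = A * ?M" by (simp add: pow_mat_commute[OF A])
  let ?X = "P * (T' * (G1' * (P\<^sup>\<dagger> * ?G)))"
  show ?thesis
  proof
    assume "is_m_core_EP_inverse A X"
    then have X: "X \<in> carrier_mat n n" and XM: "X * (A * ?M) = ?M"
      and adj: "minkowski_adjoint (A * X) = A * X" and sub: "column_space X \<subseteq> column_space ?M"
      unfolding is_m_core_EP_inverse_def pow by auto
    note [simp] = carrier_matD[OF X]
    let ?Y = "P\<^sup>\<dagger> * X"
    have XY: "X = P * ?Y" using column_space_subset_iff[OF M rb X] sub by simp
    have "X * (A * P) = X * (A * ?M) * Z" by (subst MZ) (simp add: mat_assoc)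
    then have "X * (P * T) = P" unfolding XM AP by (simp flip: MZ)
    then have "X * (P * T) * T' = P * T'" by simp
    then have "X * (P * (T * T')) = P * T'" by (simp add: mat_assoc)
    then have XP: "X * P = P * T'" by (simp add: TT' right_mult_one_mat')
    have "?Y * P = P\<^sup>\<dagger> * (X * P)" by (simp add: mat_assoc)
    then have YP: "?Y * P = T'" by (simp add: XP cancel)
    have AX: "A * X = P * (T * ?Y)"
    proof -
      have "A * X = A * P * ?Y" by (subst XY) (simp add: mat_assoc)
      then show ?thesis unfolding AP by (simp add: mat_assoc)
    qed
    \<comment> \<open>\<open>?G\<close> cancels the leading metric of the adjoint. After
      multiplication by the adjoint of \<open>P\<close>, one side collapses to
      \<open>P\<^sup>\<dagger> * ?G\<close> because \<open>T * (?Y * P)\<close> is the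
      identity.\<close>
    have "?G * minkowski_adjoint (A * X) = (A * X)\<^sup>\<dagger> * ?G"
      unfolding minkowski_adjoint_def by (simp add: mat_assoc GG)
    then have "P\<^sup>\<dagger> * ((A * X)\<^sup>\<dagger> * ?G) = P\<^sup>\<dagger> * (?G * (A * X))" unfolding adj by simp
    moreover have "P\<^sup>\<dagger> * ((A * X)\<^sup>\<dagger> * ?G) = (T * (?Y * P))\<^sup>\<dagger> * (P\<^sup>\<dagger> * ?G)"
      unfolding AX by (simp add: mat_adjoint_mult mat_assoc)
    ultimately have eq: "P\<^sup>\<dagger> * ?G = P\<^sup>\<dagger> * (?G * (P * (T * ?Y)))"
      unfolding YP TT' by (simp add: AX left_mult_one_mat')
    have "T' * (G1' * (P\<^sup>\<dagger> * ?G)) = ?Y"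
      unfolding eq by (simp add: cancel)
    then show "X = ?X" using XY by simp
  next
    assume X: "X = ?X"
    then have Xc: "X \<in> carrier_mat n n" by (auto intro: carrier_matI)
    note [simp] = carrier_matD[OF Xc]
    have A_P: "A * (P * Y) = P * (T * Y)" if "dim_row Y = r" for Y
      using that by (simp add: AP flip: mat_assoc)
    have AX: "A * X = P * (G1' * (P\<^sup>\<dagger> * ?G))"
      unfolding X by (simp add: A_P cancel)
    have "X * (A * X) = X"
      unfolding AX by (simp add: X mat_assoc cancel)
    then have "X * A * X = X" by (simp add: mat_assoc)
    moreover have "X * (A * ?M) = ?M"
    proof -
      have "A * ?M = P * (T * (P\<^sup>\<dagger> * ?M))" by (subst PM[symmetric]) (simp add: A_P)
      then have "X * (A * ?M) = P * (P\<^sup>\<dagger> * ?M)" by (simp add: X mat_assoc cancel)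
      then show ?thesis by (simp add: PM)
    qed
    moreover have "minkowski_adjoint (A * X) = A * X"
    proof -
      let ?g = "P\<^sup>\<dagger> * ?G * P"
      have g: "?g \<in> carrier_mat r r" by (intro carrier_matI) auto
      \<comment> \<open>The Gram matrix is Hermitian, hence so is its inverse \<open>G1'\<close>;
        this makes \<open>A * X\<close> self-adjoint for the metric.\<close>
      have "?g\<^sup>\<dagger> = ?g" by (simp add: mat_adjoint_mult minkowski_metric_adjoint mat_assoc)
      then have g1: "G1'\<^sup>\<dagger> * ?g = 1\<^sub>m r"
        using arg_cong[OF GG', of mat_adjoint] by (subst (asm) mat_adjoint_mult) auto
      have "G1'\<^sup>\<dagger> = G1'\<^sup>\<dagger> * (?g * G1')" unfolding GG' by (simp add: right_mult_one_mat')
      also have "\<dots> = (G1'\<^sup>\<dagger> * ?g) * G1'" by (simp add: mat_assoc)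
      also have "\<dots> = G1'" unfolding g1 by (simp add: left_mult_one_mat')
      finally have "G1'\<^sup>\<dagger> = G1'" .
      then show ?thesis
        unfolding AX minkowski_adjoint_def
        by (simp add: mat_adjoint_mult minkowski_metric_adjoint mat_assoc GG)
    qed
    moreover have "column_space X \<subseteq> column_space ?M"
      unfolding column_space_subset_iff[OF M rb Xc] by (simp add: X cancel)
    ultimately show "is_m_core_EP_inverse A X"
      unfolding is_m_core_EP_inverse_def pow using Xc by simp
  qed
qed

text \<open>The inverse \<open>X\<close> is removed from both equations of the order. On the right,
  \<open>P * T\<close> turns \<open>X\<close> into \<open>P\<close>; on the left, the Gram matrix
  times \<open>T * P\<^sup>\<dagger>\<close> turns \<open>X\<close> into
  \<open>P\<^sup>\<dagger>\<close> times the metric.\<close>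

lemma m_core_EP_le_range:
  assumes n: "1 \<le> n" and A: "A \<in> carrier_mat n n" and B: "B \<in> carrier_mat n n"
    and rb: "range_basis (A ^\<^sub>m mat_index A) r P"
    and rk: "rk (minkowski_adjoint (A ^\<^sub>m mat_index A) * A ^\<^sub>m mat_index A) = r"
    and le: "m_core_EP_le A B"
  shows "B * P = A * P" "P\<^sup>\<dagger> * minkowski_metric n * A = P\<^sup>\<dagger> * minkowski_metric n * B"
proof -
  let ?M = "A ^\<^sub>m mat_index A" and ?G = "minkowski_metric n"
  have M: "?M \<in> carrier_mat n n" using A by simp
  have P: "P \<in> carrier_mat n r" and PP: "P\<^sup>\<dagger> * P = 1\<^sub>m r"
    by (rule range_basisE[OF rb M]; simp)+
  obtain T T' where T: "T \<in> carrier_mat r r" and T': "T' \<in> carrier_mat r r" and AP: "A * P = P * T"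
    and TT': "T * T' = 1\<^sub>m r" and T'T: "T' * T = 1\<^sub>m r"
    using core_restriction[OF A rb] by blast
  let ?g = "P\<^sup>\<dagger> * ?G * P"
  obtain G1' where G': "G1' \<in> carrier_mat r r" and GG': "?g * G1' = 1\<^sub>m r" and G'G: "G1' * ?g = 1\<^sub>m r"
    using gram_inverse[OF n M rb rk] by blast
  have G: "?G \<in> carrier_mat n n" using n by simp
  note [simp] = carrier_matD[OF A] carrier_matD[OF B] carrier_matD[OF P]
    carrier_matD[OF G] carrier_matD[OF T] carrier_matD[OF T'] carrier_matD[OF G']
  define X where "X = P * (T' * (G1' * (P\<^sup>\<dagger> * ?G)))"
  have [simp]: "dim_row X = n" "dim_col X = n" by (simp_all add: X_def)
  have "m_core_EP_inverse A = X"
    unfolding m_core_EP_inverse_def X_def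
    using is_m_core_EP_inverse_iff[OF n A rb T T' AP TT' T'T G' GG' G'G] by (intro the_equality) auto
  then have XA: "X * A = X * B" and AX: "A * X = B * X"
    using le unfolding m_core_EP_le_def by auto
  have "X * (P * T) = P * (T' * (G1' * ?g * T))" by (simp add: X_def mat_assoc)
  then have XP: "X * (P * T) = P" by (simp add: G'G T'T left_mult_one_mat' right_mult_one_mat')
  have "B * P = B * X * (P * T)" "A * P = A * X * (P * T)" using XP by (simp_all add: mat_assoc)
  then show "B * P = A * P" by (simp add: AX)
  have "?g * (T * (P\<^sup>\<dagger> * X)) = ?g * (T * ((P\<^sup>\<dagger> * P) * (T' * (G1' * (P\<^sup>\<dagger> * ?G)))))"
    by (simp add: X_def mat_assoc)
  also have "\<dots> = ?g * ((T * T') * (G1' * (P\<^sup>\<dagger> * ?G)))"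
    by (simp add: PP left_mult_one_mat' mat_assoc)
  also have "\<dots> = (?g * G1') * (P\<^sup>\<dagger> * ?G)"
    by (simp add: TT' left_mult_one_mat' mat_assoc)
  finally have gX: "?g * (T * (P\<^sup>\<dagger> * X)) = P\<^sup>\<dagger> * ?G" by (simp add: GG' left_mult_one_mat')
  have gXC: "P\<^sup>\<dagger> * ?G * C = ?g * (T * (P\<^sup>\<dagger> * (X * C)))" if "dim_row C = n" for C
    using arg_cong[OF gX, of "\<lambda>Y. Y * C"] that by (simp add: mat_assoc)
  have "P\<^sup>\<dagger> * ?G * A = ?g * (T * (P\<^sup>\<dagger> * (X * A)))" by (rule gXC) simp
  also have "\<dots> = P\<^sup>\<dagger> * ?G * B" unfolding XA by (rule gXC[symmetric]) simp
  finally show "P\<^sup>\<dagger> * ?G * A = P\<^sup>\<dagger> * ?G * B" .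
qed

section \<open>Block decompositions\<close>

text \<open>The columns of \<open>P\<close> span an \<open>A\<close>-invariant subspace that
  \<open>N\<^sup>\<dagger>\<close> annihilates, so only the \<open>N\<close> part of the resolved
  identity survives.\<close>

lemma complement_mult:
  fixes A :: "complex mat"
  assumes A: "A \<in> carrier_mat n n" and P: "P \<in> carrier_mat n a" and N: "N \<in> carrier_mat n b"
    and T: "T \<in> carrier_mat a a" and AP: "A * P = P * T"
    and NP: "N\<^sup>\<dagger> * P = 0\<^sub>m b a" and PN: "P * P\<^sup>\<dagger> + N * N\<^sup>\<dagger> = 1\<^sub>m n"
  shows "N\<^sup>\<dagger> * A = N\<^sup>\<dagger> * A * N * N\<^sup>\<dagger>"
proof -
  note [simp] = carrier_matD[OF A] carrier_matD[OF P] carrier_matD[OF N] carrier_matD[OF T]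
  have NA: "N\<^sup>\<dagger> * A \<in> carrier_mat b n" by (intro carrier_matI) auto
  have "N\<^sup>\<dagger> * A * (P * P\<^sup>\<dagger>) = N\<^sup>\<dagger> * (A * P) * P\<^sup>\<dagger>" by (simp add: mat_assoc)
  also have "\<dots> = N\<^sup>\<dagger> * P * T * P\<^sup>\<dagger>" unfolding AP by (simp add: mat_assoc)
  also have "\<dots> = 0\<^sub>m b n" using T P by (simp add: NP)
  finally have zero: "N\<^sup>\<dagger> * A * (P * P\<^sup>\<dagger>) = 0\<^sub>m b n" .
  have "N\<^sup>\<dagger> * A = N\<^sup>\<dagger> * A * (P * P\<^sup>\<dagger> + N * N\<^sup>\<dagger>)" using NA by (simp add: PN)
  also have "\<dots> = N\<^sup>\<dagger> * A * (P * P\<^sup>\<dagger>) + N\<^sup>\<dagger> * A * (N * N\<^sup>\<dagger>)"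
    by (rule mult_add_distrib_mat[OF NA]; intro carrier_matI; simp)
  also have "\<dots> = N\<^sup>\<dagger> * A * (N * N\<^sup>\<dagger>)" unfolding zero by (rule left_add_zero_mat; intro carrier_matI; simp)
  also have "\<dots> = N\<^sup>\<dagger> * A * N * N\<^sup>\<dagger>" by (simp add: mat_assoc)
  finally show ?thesis .
qed

text \<open>The compression to the complement is the map that \<open>A\<close> induces modulo the
  range of \<open>P\<close>. \<open>A ^\<^sub>m k\<close> maps everything into that range, so the
  same power of the compression vanishes.\<close>

lemma nilpotent_complement:
  fixes A :: "complex mat"
  assumes A: "A \<in> carrier_mat n n" and P: "P \<in> carrier_mat n a" and N: "N \<in> carrier_mat n b"
    and T: "T \<in> carrier_mat a a" and AP: "A * P = P * T"
    and NP: "N\<^sup>\<dagger> * P = 0\<^sub>m b a" and PN: "P * P\<^sup>\<dagger> + N * N\<^sup>\<dagger> = 1\<^sub>m n"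
    and NN: "N\<^sup>\<dagger> * N = 1\<^sub>m b" and PA: "P * (P\<^sup>\<dagger> * A ^\<^sub>m k) = A ^\<^sub>m k"
  shows "nilpotent_mat (N\<^sup>\<dagger> * A * N)"
proof -
  note [simp] = carrier_matD[OF A] carrier_matD[OF P] carrier_matD[OF N] carrier_matD[OF T]
  let ?C = "N\<^sup>\<dagger> * A * N"
  have C: "?C \<in> carrier_mat b b" by (intro carrier_matI) auto
  note cm = complement_mult[OF A P N T AP NP PN]
  have pow: "?C ^\<^sub>m j * N\<^sup>\<dagger> = N\<^sup>\<dagger> * A ^\<^sub>m j" for j
  proof (induction j)
    case 0
    then show ?case by (simp add: left_mult_one_mat' right_mult_one_mat')
  next
    case (Suc j)
    have dims [simp]: "dim_row (?C ^\<^sub>m j) = b" "dim_col (?C ^\<^sub>m j) = b"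
      "dim_row (A ^\<^sub>m j) = n" "dim_col (A ^\<^sub>m j) = n" using C A by simp_all
    have "?C ^\<^sub>m Suc j * N\<^sup>\<dagger> = ?C ^\<^sub>m j * (?C * N\<^sup>\<dagger>)" by (simp add: mat_assoc)
    also have "\<dots> = ?C ^\<^sub>m j * (N\<^sup>\<dagger> * A)" by (simp only: cm[symmetric])
    also have "\<dots> = ?C ^\<^sub>m j * N\<^sup>\<dagger> * A" by (simp add: mat_assoc)
    also have "\<dots> = N\<^sup>\<dagger> * A ^\<^sub>m Suc j" unfolding Suc by (simp add: mat_assoc)
    finally show ?case .
  qed
  have [simp]: "dim_row (?C ^\<^sub>m k) = b" "dim_col (?C ^\<^sub>m k) = b"
    "dim_row (A ^\<^sub>m k) = n" "dim_col (A ^\<^sub>m k) = n" using C A by simp_all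
  have "N\<^sup>\<dagger> * A ^\<^sub>m k = N\<^sup>\<dagger> * P * (P\<^sup>\<dagger> * A ^\<^sub>m k)"
    by (subst PA[symmetric]) (simp add: mat_assoc)
  also have "\<dots> = 0\<^sub>m b n" unfolding NP by (rule left_mult_zero_mat; intro carrier_matI; simp)
  finally have "?C ^\<^sub>m k * N\<^sup>\<dagger> * N = 0\<^sub>m b b" unfolding pow using N by simp
  moreover have "?C ^\<^sub>m k * N\<^sup>\<dagger> * N = ?C ^\<^sub>m k" by (simp add: mat_assoc NN right_mult_one_mat')
  ultimately show ?thesis
    unfolding nilpotent_mat_def by (auto intro!: exI[of _ k])
qed

section \<open>Inverses and block equations\<close>

lemma invertible_matI:
  assumes "A \<in> carrier_mat r r" "B \<in> carrier_mat r r" "A * B = 1\<^sub>m r" "B * A = 1\<^sub>m r"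
  shows "invertible_mat A"
  using assms unfolding invertible_mat_def inverts_mat_def by (auto intro!: exI[of _ B])

lemma mat_inv_eq:
  assumes G: "G \<in> carrier_mat r r" and G': "G' \<in> carrier_mat r r"
    and GG': "G * G' = 1\<^sub>m r" and G'G: "G' * G = 1\<^sub>m r"
  shows "mat_inv G = G'"
proof (cases "mat_inverse G")
  case None
  then show ?thesis
    using mat_inverse(1)[OF G None, of undefined] assms by (auto simp: Units_def ring_mat_def)
next
  case (Some H)
  then have H: "H * G = 1\<^sub>m r" "H \<in> carrier_mat r r" using mat_inverse(2)[OF G] by auto
  have "H = H * (G * G')" using H by (simp add: GG')
  also have "\<dots> = (H * G) * G'" by (rule assoc_mult_mat[OF H(2) G G', symmetric])
  also have "\<dots> = G'" unfolding H(1) using G' by simp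
  finally show ?thesis using Some by simp
qed

lemma block3_gram:
  fixes P Q V M :: "complex mat"
  assumes P: "P \<in> carrier_mat n a" and Q: "Q \<in> carrier_mat n b" and V: "V \<in> carrier_mat n c"
    and M: "M \<in> carrier_mat n n"
  shows "(P @\<^sub>c Q @\<^sub>c V)\<^sup>\<dagger> * M * (P @\<^sub>c Q @\<^sub>c V) = block3_mat
    (P\<^sup>\<dagger> * M * P) (P\<^sup>\<dagger> * M * Q) (P\<^sup>\<dagger> * M * V)
    (Q\<^sup>\<dagger> * M * P) (Q\<^sup>\<dagger> * M * Q) (Q\<^sup>\<dagger> * M * V)
    (V\<^sup>\<dagger> * M * P) (V\<^sup>\<dagger> * M * Q) (V\<^sup>\<dagger> * M * V)"
proof -
  note [simp] = carrier_matD[OF P] carrier_matD[OF Q] carrier_matD[OF V] carrier_matD[OF M]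
  have rows: "(P @\<^sub>c Q @\<^sub>c V)\<^sup>\<dagger> * M * X = P\<^sup>\<dagger> * M * X @\<^sub>r Q\<^sup>\<dagger> * M * X @\<^sub>r V\<^sup>\<dagger> * M * X"
    if "dim_row X = n" for X
    using that by (simp add: mat_adjoint_append_cols append_rows_mult del: assoc_mult_mat)
  show ?thesis
    unfolding block3_mat_def by (subst rows) (simp_all add: mult_append_cols del: assoc_mult_mat)
qed

text \<open>Subtracting the two sides expresses \<open>g * (x' - x)\<close> as the row
  \<open>(h1, h2)\<close> times the column of differences, and \<open>g'\<close> removes
  \<open>g\<close>. This is the source of the correction terms in the first block row of
  \<open>B\<close>.\<close>

lemma solve_block_row:
  fixes g g' x x' y y' z z' :: "complex mat"
  assumes g: "g \<in> carrier_mat r r" and g': "g' \<in> carrier_mat r r" and inv: "g' * g = 1\<^sub>m r"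
    and h1: "h1 \<in> carrier_mat r a" and h2: "h2 \<in> carrier_mat r b"
    and x: "x \<in> carrier_mat r m" "x' \<in> carrier_mat r m"
    and y: "y \<in> carrier_mat a m" "y' \<in> carrier_mat a m"
    and z: "z \<in> carrier_mat b m" "z' \<in> carrier_mat b m"
    and eq: "g * x + (h1 * y + h2 * z) = g * x' + (h1 * y' + h2 * z')"
  shows "x' = x + g' * (h1 @\<^sub>c h2) * ((y - y') @\<^sub>r (z - z'))"
proof -
  have diff: "(b - b') + (c - c') = a' - a"
    if c: "a \<in> carrier_mat r m" "a' \<in> carrier_mat r m" "b \<in> carrier_mat r m" "b' \<in> carrier_mat r m"
      "c \<in> carrier_mat r m" "c' \<in> carrier_mat r m" and e: "a + (b + c) = a' + (b' + c')"
    for a a' b b' c c' :: "complex mat"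
  proof (rule eq_matI)
    fix i j assume "i < dim_row (a' - a)" "j < dim_col (a' - a)"
    then have ij: "i < r" "j < m" using c by auto
    have "(a + (b + c)) $$ (i, j) = (a' + (b' + c')) $$ (i, j)" using e by simp
    then show "((b - b') + (c - c')) $$ (i, j) = (a' - a) $$ (i, j)"
      using ij c by (simp add: algebra_simps)
  qed (use c in auto)
  note [simp] = carrier_matD[OF g] carrier_matD[OF g'] carrier_matD[OF h1] carrier_matD[OF h2]
    carrier_matD[OF x(1)] carrier_matD[OF x(2)] carrier_matD[OF y(1)] carrier_matD[OF y(2)]
    carrier_matD[OF z(1)] carrier_matD[OF z(2)]
  have "(h1 @\<^sub>c h2) * ((y - y') @\<^sub>r (z - z')) = h1 * (y - y') + h2 * (z - z')"
    by (rule append_cols_mult_append_rows) auto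
  also have "\<dots> = (h1 * y - h1 * y') + (h2 * z - h2 * z')"
    using mult_minus_distrib_mat[OF h1 y] mult_minus_distrib_mat[OF h2 z] by simp
  also have "\<dots> = g * x' - g * x"
    by (rule diff[OF _ _ _ _ _ _ eq]; intro carrier_matI; simp)
  also have "\<dots> = g * (x' - x)" using mult_minus_distrib_mat[OF g x(2) x(1)] by simp
  finally have "g' * (h1 @\<^sub>c h2) * ((y - y') @\<^sub>r (z - z')) = g' * g * (x' - x)"
    by (simp add: mat_assoc)
  also have "\<dots> = x' - x" by (simp add: inv left_mult_one_mat')
  finally show ?thesis using x by (auto intro!: eq_matI)
qed

text \<open>\<open>B\<close> acts invertibly on the range of \<open>P\<close>, so \<open>P\<close>
  is recovered from its image under the \<open>j\<close>-th power by \<open>Y\<close>, the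
  \<open>j\<close>-th power of \<open>T'\<close>.\<close>

lemma invariant_in_range:
  fixes B :: "complex mat"
  assumes B: "B \<in> carrier_mat n n" and P: "P \<in> carrier_mat n r" and BP: "B * P = P * T"
    and T: "T \<in> carrier_mat r r" and T': "T' \<in> carrier_mat r r" and TT': "T * T' = 1\<^sub>m r"
  shows "\<exists>Y \<in> carrier_mat r r. P = B ^\<^sub>m j * P * Y"
proof (induction j)
  case 0
  then show ?case using B P by (intro bexI[of _ "1\<^sub>m r"]) auto
next
  case (Suc j)
  then obtain Y where Y: "Y \<in> carrier_mat r r" and PY: "P = B ^\<^sub>m j * P * Y" by blast
  have Bj: "B ^\<^sub>m j \<in> carrier_mat n n" using B by simp
  note [simp] = carrier_matD[OF B] carrier_matD[OF Bj] carrier_matD[OF P] carrier_matD[OF T]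
    carrier_matD[OF T'] carrier_matD[OF Y]
  have "B ^\<^sub>m Suc j * P * (T' * Y) = B ^\<^sub>m j * (B * P) * (T' * Y)" by (simp add: mat_assoc)
  also have "\<dots> = B ^\<^sub>m j * (P * ((T * T') * Y))" unfolding BP by (simp add: mat_assoc)
  also have "\<dots> = B ^\<^sub>m j * P * Y" by (simp add: TT' left_mult_one_mat' mat_assoc)
  also have "\<dots> = P" by (rule PY[symmetric])
  finally show ?case by (rule bexI[OF sym mult_carrier_mat[OF T' Y]])
qed

text \<open>The extension is made in the coordinates of \<open>Q\<close>: there \<open>P\<close>
  becomes an orthonormal family \<open>C\<close>, which is completed by \<open>E\<close>, and
  \<open>D = Q * E\<close> carries the result back. A completion \<open>V\<close> of
  \<open>Q\<close> also completes \<open>(P, D)\<close>, as both span the same space.\<close>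

lemma range_basis_extension:
  fixes M :: "complex mat"
  assumes M: "M \<in> carrier_mat n n" and Q: "range_basis M s Q"
    and P: "P \<in> carrier_mat n r" and PP: "P\<^sup>\<dagger> * P = 1\<^sub>m r"
    and PM: "P = M * Y" and Y: "Y \<in> carrier_mat n r"
  obtains D V where "D \<in> carrier_mat n (s - r)" "V \<in> carrier_mat n (n - s)" "r \<le> s"
    "range_basis M s (P @\<^sub>c D)" "P\<^sup>\<dagger> * D = 0\<^sub>m r (s - r)"
    "D\<^sup>\<dagger> * P = 0\<^sub>m (s - r) r" "D\<^sup>\<dagger> * D = 1\<^sub>m (s - r)"
    "V\<^sup>\<dagger> * P = 0\<^sub>m (n - s) r" "V\<^sup>\<dagger> * D = 0\<^sub>m (n - s) (s - r)" "D\<^sup>\<dagger> * V = 0\<^sub>m (s - r) (n - s)"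
    "V\<^sup>\<dagger> * V = 1\<^sub>m (n - s)"
    "P * P\<^sup>\<dagger> + (D * D\<^sup>\<dagger> + V * V\<^sup>\<dagger>) = 1\<^sub>m n"
proof -
  obtain Z where Qc: "Q \<in> carrier_mat n s" and QQ: "Q\<^sup>\<dagger> * Q = 1\<^sub>m s"
    and QM: "Q * (Q\<^sup>\<dagger> * M) = M" and Z: "Z \<in> carrier_mat n s" and MZ: "Q = M * Z"
    by (rule range_basisE[OF Q M])
  note [simp] = carrier_matD[OF M] carrier_matD[OF Qc] carrier_matD[OF P] carrier_matD[OF Y]
    carrier_matD[OF Z]
  define C where "C = Q\<^sup>\<dagger> * P"
  have C: "C \<in> carrier_mat s r" unfolding C_def by (intro carrier_matI) auto
  note [simp] = carrier_matD[OF C]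
  have "Q * C = Q * (Q\<^sup>\<dagger> * M) * Y" unfolding C_def PM by (simp add: mat_assoc)
  then have QC: "Q * C = P" unfolding QM by (simp flip: PM)
  have "C\<^sup>\<dagger> * C = (Q * C)\<^sup>\<dagger> * P" unfolding C_def by (simp add: mat_adjoint_mult mat_assoc)
  then have CC: "C\<^sup>\<dagger> * C = 1\<^sub>m r" by (simp add: QC PP)
  have rs: "r \<le> s" using left_invertible_bound[OF C _ CC] C by simp
  obtain E where E: "E \<in> carrier_mat s (s - r)" and EE: "E\<^sup>\<dagger> * E = 1\<^sub>m (s - r)"
    and CE: "C\<^sup>\<dagger> * E = 0\<^sub>m r (s - r)" and EC: "E\<^sup>\<dagger> * C = 0\<^sub>m (s - r) r"
    and sumCE: "C * C\<^sup>\<dagger> + E * E\<^sup>\<dagger> = 1\<^sub>m s"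
    using orthonormal_completion[OF C CC] by blast
  obtain V where V: "V \<in> carrier_mat n (n - s)" and VV: "V\<^sup>\<dagger> * V = 1\<^sub>m (n - s)"
    and QV: "Q\<^sup>\<dagger> * V = 0\<^sub>m s (n - s)" and VQ: "V\<^sup>\<dagger> * Q = 0\<^sub>m (n - s) s"
    and sumQV: "Q * Q\<^sup>\<dagger> + V * V\<^sup>\<dagger> = 1\<^sub>m n"
    using orthonormal_completion[OF Qc QQ] by blast
  note [simp] = carrier_matD[OF E] carrier_matD[OF V]
  define D where "D = Q * E"
  have D: "D \<in> carrier_mat n (s - r)" unfolding D_def by (intro carrier_matI) auto
  note [simp] = carrier_matD[OF D]
  have QQc: "Q\<^sup>\<dagger> * (Q * X) = X" if "dim_row X = s" for X
    using that by (simp add: QQ left_mult_one_mat' flip: mat_assoc)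
  have PD: "P\<^sup>\<dagger> * D = 0\<^sub>m r (s - r)" and DP: "D\<^sup>\<dagger> * P = 0\<^sub>m (s - r) r" and DD: "D\<^sup>\<dagger> * D = 1\<^sub>m (s - r)"
    unfolding QC[symmetric] D_def by (simp_all add: mat_adjoint_mult mat_assoc QQc CE EC EE)
  have "V\<^sup>\<dagger> * P = V\<^sup>\<dagger> * Q * C" "V\<^sup>\<dagger> * D = V\<^sup>\<dagger> * Q * E" "D\<^sup>\<dagger> * V = E\<^sup>\<dagger> * (Q\<^sup>\<dagger> * V)"
    unfolding QC[symmetric] D_def by (simp_all add: mat_adjoint_mult mat_assoc)
  then have VP: "V\<^sup>\<dagger> * P = 0\<^sub>m (n - s) r" and VD: "V\<^sup>\<dagger> * D = 0\<^sub>m (n - s) (s - r)"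
    and DV: "D\<^sup>\<dagger> * V = 0\<^sub>m (s - r) (n - s)"
    unfolding VQ QV using C E by (simp_all add: right_mult_zero_mat[of _ "s - r" s])
  \<comment> \<open>\<open>C\<close> and \<open>E\<close> resolve the identity in coordinates, so
    the new basis has the same projection as \<open>Q\<close>.\<close>
  have PQ: "P * P\<^sup>\<dagger> + D * D\<^sup>\<dagger> = Q * Q\<^sup>\<dagger>"
  proof -
    have "P * P\<^sup>\<dagger> + D * D\<^sup>\<dagger> = Q * (C * C\<^sup>\<dagger>) * Q\<^sup>\<dagger> + Q * (E * E\<^sup>\<dagger>) * Q\<^sup>\<dagger>"
      unfolding QC[symmetric] D_def by (simp add: mat_adjoint_mult mat_assoc)
    also have "\<dots> = (Q * (C * C\<^sup>\<dagger>) + Q * (E * E\<^sup>\<dagger>)) * Q\<^sup>\<dagger>"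
      by (rule add_mult_distrib_mat[symmetric, of _ n s _ _ n]; intro carrier_matI; simp)
    also have "Q * (C * C\<^sup>\<dagger>) + Q * (E * E\<^sup>\<dagger>) = Q * (C * C\<^sup>\<dagger> + E * E\<^sup>\<dagger>)"
      by (rule mult_add_distrib_mat[symmetric, OF Qc, of _ s]; intro carrier_matI; simp)
    finally show ?thesis unfolding sumCE by (simp add: right_mult_one_mat')
  qed
  have "P * P\<^sup>\<dagger> + (D * D\<^sup>\<dagger> + V * V\<^sup>\<dagger>) = P * P\<^sup>\<dagger> + D * D\<^sup>\<dagger> + V * V\<^sup>\<dagger>"
    by (rule assoc_add_mat[symmetric, of _ n n]; intro carrier_matI; simp)
  also have "\<dots> = 1\<^sub>m n" unfolding PQ by (rule sumQV)
  finally have sum: "P * P\<^sup>\<dagger> + (D * D\<^sup>\<dagger> + V * V\<^sup>\<dagger>) = 1\<^sub>m n" .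
  let ?Q = "P @\<^sub>c D"
  have "?Q\<^sup>\<dagger> * 1\<^sub>m n * ?Q = 1\<^sub>m (r + (s - r))"
    using four_block_gram[OF P D one_carrier_mat]
    by (simp add: PP PD DP DD four_block_one right_mult_one_mat')
  then have "?Q\<^sup>\<dagger> * ?Q = 1\<^sub>m s" using rs by (simp add: right_mult_one_mat')
  moreover have "?Q * (?Q\<^sup>\<dagger> * M) = M"
  proof -
    have "?Q * (?Q\<^sup>\<dagger> * M) = (P * P\<^sup>\<dagger> + D * D\<^sup>\<dagger>) * M"
      by (simp add: mat_adjoint_append_cols append_cols_mult_append_rows flip: mat_assoc)
    then show ?thesis unfolding PQ using QM by (simp add: mat_assoc)
  qed
  \<comment> \<open>Preimages under \<open>M\<close>: \<open>Y\<close> for \<open>P\<close>, and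
    \<open>Z * E\<close> for \<open>D\<close>, as \<open>Q = M * Z\<close>.\<close>
  moreover have "?Q = M * (Y @\<^sub>c Z * E)"
    unfolding D_def by (simp add: mult_append_cols PM[symmetric] MZ[symmetric] flip: mat_assoc)
  moreover have "?Q \<in> carrier_mat n s" "Y @\<^sub>c Z * E \<in> carrier_mat n s"
    using rs by (intro carrier_matI; simp)+
  ultimately have "range_basis M s ?Q" unfolding range_basis_def by auto
  then show ?thesis using that D V rs PD DP DD VP VD DV VV sum by blast
qed

text \<open>The resolved identity is inserted between the factors. With \<open>H\<close> the adjoint
  of \<open>P\<close> times the metric, the coefficients become the first block row of the
  metric.\<close>

lemma resolution_mult:
  fixes H Y :: "complex mat"
  assumes H: "H \<in> carrier_mat a n" and Y: "Y \<in> carrier_mat n m"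
    and P: "P \<in> carrier_mat n p" and D: "D \<in> carrier_mat n q" and V: "V \<in> carrier_mat n v"
    and sum: "P * P\<^sup>\<dagger> + (D * D\<^sup>\<dagger> + V * V\<^sup>\<dagger>) = 1\<^sub>m n"
  shows "H * Y = H * P * (P\<^sup>\<dagger> * Y) + (H * D * (D\<^sup>\<dagger> * Y) + H * V * (V\<^sup>\<dagger> * Y))"
proof -
  note [simp] = carrier_matD[OF H] carrier_matD[OF Y] carrier_matD[OF P] carrier_matD[OF D] carrier_matD[OF V]
  have "H * Y = H * (P * P\<^sup>\<dagger> + (D * D\<^sup>\<dagger> + V * V\<^sup>\<dagger>)) * Y" by (simp add: sum right_mult_one_mat')
  also have "H * (P * P\<^sup>\<dagger> + (D * D\<^sup>\<dagger> + V * V\<^sup>\<dagger>)) = H * (P * P\<^sup>\<dagger>) + H * (D * D\<^sup>\<dagger> + V * V\<^sup>\<dagger>)"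
    by (rule mult_add_distrib_mat[OF H, of _ n]; intro carrier_matI; simp)
  also have "H * (D * D\<^sup>\<dagger> + V * V\<^sup>\<dagger>) = H * (D * D\<^sup>\<dagger>) + H * (V * V\<^sup>\<dagger>)"
    by (rule mult_add_distrib_mat[OF H, of _ n]; intro carrier_matI; simp)
  also have "(H * (P * P\<^sup>\<dagger>) + (H * (D * D\<^sup>\<dagger>) + H * (V * V\<^sup>\<dagger>))) * Y =
      H * (P * P\<^sup>\<dagger>) * Y + (H * (D * D\<^sup>\<dagger>) + H * (V * V\<^sup>\<dagger>)) * Y"
    by (rule add_mult_distrib_mat[OF _ _ Y, of _ a]; intro carrier_matI; simp)
  also have "(H * (D * D\<^sup>\<dagger>) + H * (V * V\<^sup>\<dagger>)) * Y = H * (D * D\<^sup>\<dagger>) * Y + H * (V * V\<^sup>\<dagger>) * Y"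
    by (rule add_mult_distrib_mat[OF _ _ Y, of _ a]; intro carrier_matI; simp)
  finally show ?thesis by (simp add: mat_assoc)
qed

theorem theorem4p2:
  fixes A B :: "complex mat" and n k t r s :: nat
  assumes n: "1 \<le> n"
    and A: "A \<in> carrier_mat n n" and B: "B \<in> carrier_mat n n"
    and indA: "mat_index A = k" and indB: "mat_index B = t"
    and rA: "rk (A ^\<^sub>m k) = r" and rA': "rk (minkowski_adjoint (A ^\<^sub>m k) * A ^\<^sub>m k) = r"
    and sB: "rk (B ^\<^sub>m t) = s" and sB': "rk (minkowski_adjoint (B ^\<^sub>m t) * B ^\<^sub>m t) = s"
    and rs: "r \<le> s"
    and le: "m_core_EP_le A B"
  shows "\<exists>U T S1 S2 N11 N12 N13 N14 Tt Sh Nh G1 G21 G22 G31 G32 G41 G42 G43 G44.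
    U \<in> carrier_mat n n \<and> unitary_mat U \<and>
    T \<in> carrier_mat r r \<and> S1 \<in> carrier_mat r (s - r) \<and> S2 \<in> carrier_mat r (n - s) \<and>
    N11 \<in> carrier_mat (s - r) (s - r) \<and> N12 \<in> carrier_mat (s - r) (n - s) \<and>
    N13 \<in> carrier_mat (n - s) (s - r) \<and> N14 \<in> carrier_mat (n - s) (n - s) \<and>
    Tt \<in> carrier_mat (s - r) (s - r) \<and> Sh \<in> carrier_mat (s - r) (n - s) \<and>
    Nh \<in> carrier_mat (n - s) (n - s) \<and>
    G1 \<in> carrier_mat r r \<and> G21 \<in> carrier_mat r (s - r) \<and> G22 \<in> carrier_mat r (n - s) \<and>
    G31 \<in> carrier_mat (s - r) r \<and> G41 \<in> carrier_mat (s - r) (s - r) \<and>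
    G42 \<in> carrier_mat (s - r) (n - s) \<and>
    G32 \<in> carrier_mat (n - s) r \<and> G43 \<in> carrier_mat (n - s) (s - r) \<and>
    G44 \<in> carrier_mat (n - s) (n - s) \<and>
    A = U * block3_mat
              T S1 S2
              (0\<^sub>m (s - r) r) N11 N12
              (0\<^sub>m (n - s) r) N13 N14 * mat_adjoint U \<and>
    B = U * block3_mat
              T (S1 + mat_inv G1 * (G21 @\<^sub>c G22) * ((N11 - Tt) @\<^sub>r N13))
                (S2 + mat_inv G1 * (G21 @\<^sub>c G22) * ((N12 - Sh) @\<^sub>r (N14 - Nh)))
              (0\<^sub>m (s - r) r) Tt Sh
              (0\<^sub>m (n - s) r) (0\<^sub>m (n - s) (s - r)) Nh * mat_adjoint U \<and>
    mat_adjoint U * minkowski_metric n * U =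
      block3_mat G1 G21 G22 G31 G41 G42 G32 G43 G44 \<and>
    nilpotent_mat (four_block_mat N11 N12 N13 N14) \<and> nilpotent_mat Nh \<and>
    invertible_mat T \<and> invertible_mat Tt \<and> invertible_mat G1 \<and>
    invertible_mat (four_block_mat G1 G21 G31 G41)"
proof -
  let ?G = "minkowski_metric n"
  have Mk: "A ^\<^sub>m k \<in> carrier_mat n n" and Mt: "B ^\<^sub>m t \<in> carrier_mat n n" using A B by simp_all
  obtain r' P where rbP: "range_basis (A ^\<^sub>m k) r' P" using range_basis_exists by blast
  have "r' = r" using range_basis_rk[OF rbP] rA by simp
  with rbP have rbP: "range_basis (A ^\<^sub>m k) r P" by simp
  obtain s' Q where rbQ: "range_basis (B ^\<^sub>m t) s' Q" using range_basis_exists by blast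
  have "s' = s" using range_basis_rk[OF rbQ] sB by simp
  with rbQ have rbQ: "range_basis (B ^\<^sub>m t) s Q" by simp
  have sn: "s \<le> n" using rk_le_dim_row[of "B ^\<^sub>m t"] sB B by simp
  have P: "P \<in> carrier_mat n r" and PP: "P\<^sup>\<dagger> * P = 1\<^sub>m r" and PA: "P * (P\<^sup>\<dagger> * A ^\<^sub>m k) = A ^\<^sub>m k"
    by (rule range_basisE[OF rbP Mk]; simp)+
  obtain T T' where T: "T \<in> carrier_mat r r" and T': "T' \<in> carrier_mat r r" and AP: "A * P = P * T"
    and TT': "T * T' = 1\<^sub>m r" and T'T: "T' * T = 1\<^sub>m r"
    using core_restriction[OF A] rbP indA by blast
  \<comment> \<open>\<open>A\<close> and \<open>B\<close> agree on \<open>P\<close>, so they share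
    \<open>T\<close>; \<open>GAB\<close> is the half of the order that later determines the rest of
    the first block row of \<open>B\<close>.\<close>
  have BP: "B * P = P * T" and GAB: "P\<^sup>\<dagger> * ?G * A = P\<^sup>\<dagger> * ?G * B"
    using m_core_EP_le_range[OF n A B _ _ le] rbP rA' indA AP by auto
  obtain Y where Y: "Y \<in> carrier_mat r r" and PY: "P = B ^\<^sub>m t * P * Y"
    using invariant_in_range[OF B P BP T T' TT'] by blast
  \<comment> \<open>The columns of \<open>P\<close> lie in the range of
    \<open>B ^\<^sub>m t\<close>, so an orthonormal basis of that range can start with
    \<open>P\<close>.\<close>
  have PBY: "P = B ^\<^sub>m t * (P * Y)" using PY assoc_mult_mat[OF Mt P Y] by (rule trans)
  obtain D V where D: "D \<in> carrier_mat n (s - r)" and V: "V \<in> carrier_mat n (n - s)"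
    and rbPD: "range_basis (B ^\<^sub>m t) s (P @\<^sub>c D)"
    and PD: "P\<^sup>\<dagger> * D = 0\<^sub>m r (s - r)" and DP: "D\<^sup>\<dagger> * P = 0\<^sub>m (s - r) r"
    and DD: "D\<^sup>\<dagger> * D = 1\<^sub>m (s - r)"
    and VP: "V\<^sup>\<dagger> * P = 0\<^sub>m (n - s) r" and VD: "V\<^sup>\<dagger> * D = 0\<^sub>m (n - s) (s - r)"
    and DV: "D\<^sup>\<dagger> * V = 0\<^sub>m (s - r) (n - s)" and VV: "V\<^sup>\<dagger> * V = 1\<^sub>m (n - s)"
    and sum: "P * P\<^sup>\<dagger> + (D * D\<^sup>\<dagger> + V * V\<^sup>\<dagger>) = 1\<^sub>m n"
    by (rule range_basis_extension[OF Mt rbQ P PP PBY mult_carrier_mat[OF P Y]])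
  have G: "?G \<in> carrier_mat n n" using n by simp
  note [simp] = carrier_matD[OF A] carrier_matD[OF B] carrier_matD[OF P] carrier_matD[OF D]
    carrier_matD[OF V] carrier_matD[OF T] carrier_matD[OF G]
  let ?Q = "P @\<^sub>c D" and ?N = "D @\<^sub>c V" and ?U = "P @\<^sub>c D @\<^sub>c V"
  have Qc: "?Q \<in> carrier_mat n s" and Nc: "?N \<in> carrier_mat n (n - r)" and U: "?U \<in> carrier_mat n n"
    using rs sn by (intro carrier_matI; simp)+
  have UU: "?U * ?U\<^sup>\<dagger> = 1\<^sub>m n"
    by (simp add: mat_adjoint_append_cols append_cols_mult_append_rows sum)
  then have U'U: "?U\<^sup>\<dagger> * ?U = 1\<^sub>m n" using mat_mult_left_right_inverse[OF U _ UU] U by simp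
  have conj: "M = ?U * (?U\<^sup>\<dagger> * M * ?U) * ?U\<^sup>\<dagger>" if M: "M \<in> carrier_mat n n" for M
  proof -
    note [simp] = carrier_matD[OF M] carrier_matD[OF U]
    have "?U * (?U\<^sup>\<dagger> * M * ?U) * ?U\<^sup>\<dagger> = (?U * ?U\<^sup>\<dagger>) * (M * (?U * ?U\<^sup>\<dagger>))"
      using U by (simp add: mat_assoc del: dim_append_cols)
    also have "\<dots> = M" unfolding UU by (simp add: right_mult_one_mat' left_mult_one_mat')
    finally show ?thesis by (rule sym)
  qed
  \<comment> \<open>Used for both \<open>A\<close> and \<open>B\<close>: the first block column is
    \<open>T\<close> over zeros.\<close>
  have zero: "D\<^sup>\<dagger> * M * P = 0\<^sub>m (s - r) r" "V\<^sup>\<dagger> * M * P = 0\<^sub>m (n - s) r" "P\<^sup>\<dagger> * M * P = T"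
    if M: "M \<in> carrier_mat n n" "M * P = P * T" for M
  proof -
    note [simp] = carrier_matD[OF M(1)]
    have eq: "X\<^sup>\<dagger> * M * P = X\<^sup>\<dagger> * P * T" if "dim_row X = n" for X
      using that by (simp add: mat_assoc M(2))
    show "D\<^sup>\<dagger> * M * P = 0\<^sub>m (s - r) r" "V\<^sup>\<dagger> * M * P = 0\<^sub>m (n - s) r" "P\<^sup>\<dagger> * M * P = T"
      using T by (simp_all add: eq DP VP PP del: assoc_mult_mat)
  qed
  \<comment> \<open>\<open>TB\<close> is the invertible core of \<open>B\<close> in the basis
    \<open>(P, D)\<close>; its diagonal blocks will be \<open>T\<close> and
    \<open>Tt\<close>.\<close>
  obtain TB TB' where TB: "TB \<in> carrier_mat s s" and TB': "TB' \<in> carrier_mat s s"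
    and BQ: "B * ?Q = ?Q * TB" and TBB': "TB * TB' = 1\<^sub>m s"
    using core_restriction[OF B] rbPD indB by blast
  have QQ: "?Q\<^sup>\<dagger> * ?Q = 1\<^sub>m s" and QB: "?Q * (?Q\<^sup>\<dagger> * B ^\<^sub>m t) = B ^\<^sub>m t"
    by (rule range_basisE[OF rbPD Mt]; simp)+
  have VQ: "V\<^sup>\<dagger> * ?Q = 0\<^sub>m (n - s) s"
    using rs by (auto simp: mult_append_cols VP VD index_append_cols intro!: eq_matI)
  have sumQV: "?Q * ?Q\<^sup>\<dagger> + V * V\<^sup>\<dagger> = 1\<^sub>m n"
  proof -
    have "?Q * ?Q\<^sup>\<dagger> + V * V\<^sup>\<dagger> = P * P\<^sup>\<dagger> + D * D\<^sup>\<dagger> + V * V\<^sup>\<dagger>"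
      by (simp add: mat_adjoint_append_cols append_cols_mult_append_rows)
    also have "\<dots> = P * P\<^sup>\<dagger> + (D * D\<^sup>\<dagger> + V * V\<^sup>\<dagger>)"
      by (rule assoc_add_mat[of _ n n]; intro carrier_matI; simp)
    finally show ?thesis unfolding sum .
  qed
  \<comment> \<open>\<open>V\<close> is orthogonal to the \<open>B\<close>-invariant range of
    \<open>(P, D)\<close>, which gives the zero block below \<open>Tt\<close>.\<close>
  have VBD: "V\<^sup>\<dagger> * B * D = 0\<^sub>m (n - s) (s - r)"
  proof -
    have "V\<^sup>\<dagger> * B * D = V\<^sup>\<dagger> * B * V * (V\<^sup>\<dagger> * D)"
      by (subst complement_mult[OF B Qc V TB BQ VQ sumQV]) (simp add: mat_assoc)
    also have "\<dots> = 0\<^sub>m (n - s) (s - r)" unfolding VD by (rule right_mult_zero_mat; intro carrier_matI; simp)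
    finally show ?thesis .
  qed
  \<comment> \<open>For \<open>A\<close> the core is spanned by \<open>P\<close> alone, so its
    nilpotent part lives on the joined complement \<open>(D, V)\<close> of \<open>n - r\<close>
    columns.\<close>
  have NP: "?N\<^sup>\<dagger> * P = 0\<^sub>m (n - r) r"
    using rs sn
    by (auto simp: mat_adjoint_append_cols append_rows_mult DP VP index_append_rows intro!: eq_matI)
  have sumPN: "P * P\<^sup>\<dagger> + ?N * ?N\<^sup>\<dagger> = 1\<^sub>m n"
    by (simp add: mat_adjoint_append_cols append_cols_mult_append_rows sum)
  have NN: "?N\<^sup>\<dagger> * ?N = 1\<^sub>m (n - r)"
  proof -
    have "?N\<^sup>\<dagger> * 1\<^sub>m n * ?N = 1\<^sub>m ((s - r) + (n - s))"
      using four_block_gram[OF D V one_carrier_mat]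
      by (simp add: DD DV VD VV four_block_one right_mult_one_mat')
    then show ?thesis using rs sn by (simp add: right_mult_one_mat')
  qed
  define S1 S2 N11 N12 N13 N14 where defsA: "S1 = P\<^sup>\<dagger> * A * D" "S2 = P\<^sup>\<dagger> * A * V"
    "N11 = D\<^sup>\<dagger> * A * D" "N12 = D\<^sup>\<dagger> * A * V" "N13 = V\<^sup>\<dagger> * A * D" "N14 = V\<^sup>\<dagger> * A * V"
  define Tt Sh Nh where defsB: "Tt = D\<^sup>\<dagger> * B * D" "Sh = D\<^sup>\<dagger> * B * V" "Nh = V\<^sup>\<dagger> * B * V"
  define G1 G21 G22 where defsG: "G1 = P\<^sup>\<dagger> * ?G * P" "G21 = P\<^sup>\<dagger> * ?G * D" "G22 = P\<^sup>\<dagger> * ?G * V"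
  have carr: "S1 \<in> carrier_mat r (s - r)" "S2 \<in> carrier_mat r (n - s)"
    "N11 \<in> carrier_mat (s - r) (s - r)" "N12 \<in> carrier_mat (s - r) (n - s)"
    "N13 \<in> carrier_mat (n - s) (s - r)" "N14 \<in> carrier_mat (n - s) (n - s)"
    "Tt \<in> carrier_mat (s - r) (s - r)" "Sh \<in> carrier_mat (s - r) (n - s)"
    "Nh \<in> carrier_mat (n - s) (n - s)"
    "G1 \<in> carrier_mat r r" "G21 \<in> carrier_mat r (s - r)" "G22 \<in> carrier_mat r (n - s)"
    unfolding defsA defsB defsG by (intro carrier_matI; simp)+
  obtain G1' where G1': "G1' \<in> carrier_mat r r" "G1 * G1' = 1\<^sub>m r" "G1' * G1 = 1\<^sub>m r"
    using gram_inverse[OF n Mk rbP rA'] unfolding defsG by blast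
  have inv_G1: "mat_inv G1 = G1'" by (rule mat_inv_eq[OF carr(10) G1'])
  \<comment> \<open>\<open>GAB\<close> applied to \<open>X\<close> and read in the basis
    \<open>(P, D, V)\<close>. Taking \<open>X\<close> to be \<open>D\<close> or \<open>V\<close>
    gives an equation for the second or third block of the first row.\<close>
  have row: "G1 * (P\<^sup>\<dagger> * A * X) + (G21 * (D\<^sup>\<dagger> * A * X) + G22 * (V\<^sup>\<dagger> * A * X)) =
      G1 * (P\<^sup>\<dagger> * B * X) + (G21 * (D\<^sup>\<dagger> * B * X) + G22 * (V\<^sup>\<dagger> * B * X))"
    if X: "X \<in> carrier_mat n m" for X m
  proof -
    have H: "P\<^sup>\<dagger> * ?G \<in> carrier_mat r n" by (intro carrier_matI) auto
    have "P\<^sup>\<dagger> * ?G * (A * X) = P\<^sup>\<dagger> * ?G * (B * X)"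
      using assoc_mult_mat[OF H A X] assoc_mult_mat[OF H B X] GAB by simp
    from this[unfolded resolution_mult[OF H mult_carrier_mat[OF A X] P D V sum]
        resolution_mult[OF H mult_carrier_mat[OF B X] P D V sum]]
    show ?thesis unfolding defsG using X by (simp add: mat_assoc)
  qed
  have B1: "P\<^sup>\<dagger> * B * D = S1 + mat_inv G1 * (G21 @\<^sub>c G22) * ((N11 - Tt) @\<^sub>r N13)"
  proof -
    \<comment> \<open>The subtracted zero is the block \<open>V\<^sup>\<dagger> * B * D\<close>;
      hence \<open>N13\<close> stands alone in the correction term.\<close>
    have "P\<^sup>\<dagger> * B * D = S1 + G1' * (G21 @\<^sub>c G22) * ((N11 - Tt) @\<^sub>r (N13 - 0\<^sub>m (n - s) (s - r)))"
      by (rule solve_block_row[OF carr(10) G1'(1,3) carr(11,12,1) _ carr(3,7,5) zero_carrier_mat])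
        (use row[OF D] in \<open>auto simp: defsA defsB VBD simp del: assoc_mult_mat intro!: carrier_matI\<close>)
    also have "N13 - 0\<^sub>m (n - s) (s - r) = N13" using carr(5) by (auto intro!: eq_matI)
    finally show ?thesis unfolding inv_G1 .
  qed
  have B2: "P\<^sup>\<dagger> * B * V = S2 + mat_inv G1 * (G21 @\<^sub>c G22) * ((N12 - Sh) @\<^sub>r (N14 - Nh))"
    unfolding inv_G1
    by (rule solve_block_row[OF carr(10) G1'(1,3) carr(11,12,2) _ carr(4,8,6,9)])
      (use row[OF V] in \<open>auto simp: defsA defsB simp del: assoc_mult_mat intro!: carrier_matI\<close>)
  have blkA: "?U\<^sup>\<dagger> * A * ?U = block3_mat T S1 S2 (0\<^sub>m (s - r) r) N11 N12 (0\<^sub>m (n - s) r) N13 N14"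
    unfolding block3_gram[OF P D V A] zero[OF A AP] defsA ..
  have blkB: "?U\<^sup>\<dagger> * B * ?U = block3_mat
      T (S1 + mat_inv G1 * (G21 @\<^sub>c G22) * ((N11 - Tt) @\<^sub>r N13))
        (S2 + mat_inv G1 * (G21 @\<^sub>c G22) * ((N12 - Sh) @\<^sub>r (N14 - Nh)))
      (0\<^sub>m (s - r) r) Tt Sh (0\<^sub>m (n - s) r) (0\<^sub>m (n - s) (s - r)) Nh"
    unfolding block3_gram[OF P D V B] zero[OF B BP] VBD B1 B2 unfolding defsB ..
  have blkG: "?U\<^sup>\<dagger> * ?G * ?U = block3_mat G1 G21 G22
      (D\<^sup>\<dagger> * ?G * P) (D\<^sup>\<dagger> * ?G * D) (D\<^sup>\<dagger> * ?G * V)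
      (V\<^sup>\<dagger> * ?G * P) (V\<^sup>\<dagger> * ?G * D) (V\<^sup>\<dagger> * ?G * V)"
    unfolding block3_gram[OF P D V G] defsG ..
  have nilA: "nilpotent_mat (four_block_mat N11 N12 N13 N14)"
  proof -
    have "?N\<^sup>\<dagger> * A * ?N = four_block_mat N11 N12 N13 N14"
      unfolding four_block_gram[OF D V A] defsA by (rule append_cols_four_block) auto
    then show ?thesis using nilpotent_complement[OF A P Nc T AP NP sumPN NN PA] by simp
  qed
  have nilB: "nilpotent_mat Nh"
    unfolding defsB by (rule nilpotent_complement[OF B Qc V TB BQ VQ sumQV VV QB])
  have invT: "invertible_mat T" by (rule invertible_matI[OF T T' TT' T'T])
  have invTt: "invertible_mat Tt"
  proof -
    \<comment> \<open>\<open>TB\<close> is block triangular with diagonal \<open>T\<close>,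
      \<open>Tt\<close>, so its nonzero determinant is the product of theirs.\<close>
    have "TB = ?Q\<^sup>\<dagger> * ?Q * TB" unfolding QQ using TB by simp
    also have "\<dots> = ?Q\<^sup>\<dagger> * B * ?Q"
      using carrier_matD[OF TB] carrier_matD[OF Qc] BQ by (simp add: mat_assoc del: dim_append_cols)
    also have "\<dots> = four_block_mat T (P\<^sup>\<dagger> * B * D) (0\<^sub>m (s - r) r) Tt"
      unfolding four_block_gram[OF P D B] zero[OF B BP] defsB by (rule append_cols_four_block) auto
    finally have "det TB = det (four_block_mat T (P\<^sup>\<dagger> * B * D) (0\<^sub>m (s - r) r) Tt)"
      by (rule arg_cong)
    also have "\<dots> = det T * det Tt"
      by (rule det_four_block_mat_lower_left_zero[OF T _ refl carr(7)]; intro carrier_matI; simp)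
    finally have "det TB = det T * det Tt" .
    moreover have "det TB * det TB' = 1" using det_mult[OF TB TB'] by (simp add: TBB')
    ultimately have "det Tt \<noteq> 0" by auto
    from det_non_zero_imp_unit[OF carr(7) this, of undefined] show ?thesis
      using invertible_matI[OF carr(7)] by (auto simp: Units_def ring_mat_def)
  qed
  have invG: "invertible_mat (four_block_mat G1 G21 (D\<^sup>\<dagger> * ?G * P) (D\<^sup>\<dagger> * ?G * D))"
  proof -
    \<comment> \<open>The leading \<open>s\<close> by \<open>s\<close> block of the metric is the
      Gram matrix of \<open>(P, D)\<close>, so the rank condition on \<open>B ^\<^sub>m t\<close>
      makes it invertible, as that on \<open>A ^\<^sub>m k\<close> did for
      \<open>G1\<close>.\<close>
    have eq: "?Q\<^sup>\<dagger> * ?G * ?Q = four_block_mat G1 G21 (D\<^sup>\<dagger> * ?G * P) (D\<^sup>\<dagger> * ?G * D)"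
      unfolding four_block_gram[OF P D G] defsG by (rule append_cols_four_block) auto
    have "?Q\<^sup>\<dagger> * ?G * ?Q \<in> carrier_mat s s" using Qc by (intro carrier_matI) auto
    then show ?thesis
      unfolding eq[symmetric] using gram_inverse[OF n Mt rbPD sB'] invertible_matI by blast
  qed
  have unit: "unitary_mat ?U"
    unfolding unitary_mat_def square_mat.simps using carrier_matD[OF U] UU U'U by simp
  show ?thesis
  \<comment> \<open>The remaining metric blocks are supplied in the quantifier order
    \<open>G31\<close>, \<open>G32\<close>, \<open>G41\<close>, \<open>G42\<close>,
    \<open>G43\<close>, \<open>G44\<close>, which is not row by row.\<close>
  proof (rule exI[of _ ?U], rule exI[of _ T], rule exI[of _ S1], rule exI[of _ S2],
      rule exI[of _ N11], rule exI[of _ N12], rule exI[of _ N13], rule exI[of _ N14],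
      rule exI[of _ Tt], rule exI[of _ Sh], rule exI[of _ Nh],
      rule exI[of _ G1], rule exI[of _ G21], rule exI[of _ G22],
      rule exI[of _ "D\<^sup>\<dagger> * ?G * P"], rule exI[of _ "V\<^sup>\<dagger> * ?G * P"], rule exI[of _ "D\<^sup>\<dagger> * ?G * D"],
      rule exI[of _ "D\<^sup>\<dagger> * ?G * V"], rule exI[of _ "V\<^sup>\<dagger> * ?G * D"], rule exI[of _ "V\<^sup>\<dagger> * ?G * V"],
      intro conjI)
    show "A = ?U * block3_mat T S1 S2 (0\<^sub>m (s - r) r) N11 N12 (0\<^sub>m (n - s) r) N13 N14 * ?U\<^sup>\<dagger>"
      unfolding blkA[symmetric] by (rule conj[OF A])
    show "B = ?U * block3_mat
        T (S1 + mat_inv G1 * (G21 @\<^sub>c G22) * ((N11 - Tt) @\<^sub>r N13))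
          (S2 + mat_inv G1 * (G21 @\<^sub>c G22) * ((N12 - Sh) @\<^sub>r (N14 - Nh)))
        (0\<^sub>m (s - r) r) Tt Sh (0\<^sub>m (n - s) r) (0\<^sub>m (n - s) (s - r)) Nh * ?U\<^sup>\<dagger>"
      unfolding blkB[symmetric] by (rule conj[OF B])
  qed (rule U unit T carr blkG nilA nilB invT invTt invG invertible_matI[OF carr(10) G1']
      | (intro carrier_matI; simp; fail))+
qed

end
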